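(* Let $f(z)=z+\sum_{n=2}^{\infty}a_nz^n\in\mathcal{C}_2$ and let $p\ge1$. Then $$|z|+\sum_{n=2}^{\infty}|a_nz^n|+\sum_{n=2}^{\infty}|a_n|^{p}|z|^{np}\le d(f(0),\partial f(\mathbb{D}))$$ for $|z|\le r^*_{p}$, where $r^*_{p}$ is the solution in $(0,1)$ of $$1-3r-r^p-2r^{2p}+3r^{1+p}+2r^{1+2p}=0.$$ The result is sharp, i.e. for each $p\ge1$ the number $r^*_p$ cannot be replaced by any larger number such that the inequality still holds for all $f\in\mathcal{C}_2$.
   Context: $\mathbb{D}=\{z\in\mathbb{C}:|z|<1\}$; $d$ is the Euclidean distance and $\partial f(\mathbb{D})$ is the boundary of $f(\mathbb{D})$. A convex function is a univalent analytic function on $\mathbb{D}$ whose image is a convex domain. The class $\mathcal{C}_2$ consists of the analytic functions $f(z)=z+\sum_{n=2}^\infty a_nz^n$ on $\mathbb{D}$ for which there exists a convex function $g(z)=b_1z+\cdots$ with $\operatorname{Re}(b_1)>0$ such that $\operatorname{Re}\left(\frac{(zf'(z))'}{g'(z)}\right)>0$ for all $z\in\mathbb{D}$. Here $p$ is a real number. *)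

theory Defs
  imports "HOL-Complex_Analysis.Complex_Analysis"
begin

text \<open>Functions on the unit disc are total functions of which only the values on
  \<^term>\<open>ball (0::complex) 1\<close> matter.\<close>

definition convex_function :: "(complex \<Rightarrow> complex) \<Rightarrow> bool" where
  "convex_function g \<longleftrightarrow>
     g holomorphic_on ball 0 1 \<and> inj_on g (ball 0 1) \<and> convex (g ` ball 0 1)"

text \<open>The normalisations \<open>f(z) = z + \<dots>\<close> and \<open>g(z) = b\<^sub>1 z + \<dots>\<close> of the
  Taylor expansions are the conditions on the value and the first derivative at \<open>0\<close>.\<close>

definition class_C2 :: "(complex \<Rightarrow> complex) set" where
  "class_C2 = {f. f holomorphic_on ball 0 1 \<and> f 0 = 0 \<and> deriv f 0 = 1 \<and>
     (\<exists>g. convex_function g \<and> g 0 = 0 \<and> Re (deriv g 0) > 0 \<and>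
        (\<forall>z\<in>ball 0 1. Re (deriv (\<lambda>w. w * deriv f w) z / deriv g z) > 0))}"

definition taylor_coeff :: "(complex \<Rightarrow> complex) \<Rightarrow> nat \<Rightarrow> complex" where
  "taylor_coeff f n = fps_nth (fps_expansion f 0) n"

text \<open>The two series start at index \<open>2\<close>, hence the shift. The real exponent \<open>p\<close> requires
  \<open>powr\<close>; for vanishing bases the library's \<open>0 powr x = 0\<close> is the intended value, the
  exponents being positive.\<close>

definition majorant_term :: "(complex \<Rightarrow> complex) \<Rightarrow> complex \<Rightarrow> nat \<Rightarrow> real" where
  "majorant_term f z k = norm (taylor_coeff f (k + 2) * z ^ (k + 2))"

definition power_term :: "real \<Rightarrow> (complex \<Rightarrow> complex) \<Rightarrow> complex \<Rightarrow> nat \<Rightarrow> real" where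
  "power_term p f z k =
     norm (taylor_coeff f (k + 2)) powr p * norm z powr (real (k + 2) * p)"

definition bohr_sum :: "real \<Rightarrow> (complex \<Rightarrow> complex) \<Rightarrow> complex \<Rightarrow> real" where
  "bohr_sum p f z = norm z + (\<Sum>k. majorant_term f z k) + (\<Sum>k. power_term p f z k)"

text \<open>\<^const>\<open>infdist\<close> to the empty set is \<open>0\<close>, so a positive lower bound on this distance
  entails that the boundary is nonempty.\<close>

definition boundary_dist :: "(complex \<Rightarrow> complex) \<Rightarrow> real" where
  "boundary_dist f = infdist (f 0) (frontier (f ` ball 0 1))"

definition radius_equation :: "real \<Rightarrow> real \<Rightarrow> bool" where
  "radius_equation p r \<longleftrightarrow>
     1 - 3 * r - r powr p - 2 * r powr (2 * p) + 3 * r powr (1 + p) + 2 * r powr (1 + 2 * p) = 0"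

definition bohr_radius :: "real \<Rightarrow> real" where
  "bohr_radius p = (THE r. 0 < r \<and> r < 1 \<and> radius_equation p r)"

end

theory Submission
  imports Defs
begin

text \<open>Let \<open>F(z) = z f'(z)\<close> and \<open>q = F'/g'\<close>, so that \<open>Re q > 0\<close> and \<open>q(0) g'(0) = 1\<close>. The bounds
  \<open>|b\<^sub>n| \<le> |b\<^sub>1|\<close> for convex functions and \<open>|q\<^sub>n| \<le> 2 Re q(0)\<close> turn \<open>F' = q g'\<close> into \<open>|a\<^sub>n| \<le> 1\<close>.
  The lower bounds for \<open>|q|\<close> and \<open>|g'|\<close> give \<open>|F'(z)| \<ge> (1 - r) / (1 + r)\<^sup>3\<close> with \<open>r = |z|\<close>. As \<open>F\<close> is
  univalent, inverting it along rays yields \<open>|F(z)| \<ge> r / (1 + r)\<^sup>2\<close>, that is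
  \<open>|f'(z)| \<ge> 1 / (1 + r)\<^sup>2\<close>, and the same argument for \<open>f\<close> shows that \<open>f\<close> covers the disc of
  radius \<open>1/2\<close>. Univalence of \<open>f\<close> guarantees that its image has a boundary at all. So the Bohr sum
  is at most \<open>r / (1 - r) + r\<^sup>2\<^sup>p / (1 - r\<^sup>p)\<close>, which is \<open>1/2\<close> exactly at the root of the given
  equation, and the half-plane map \<open>z / (1 - z)\<close> attains all bounds.\<close>

subsection \<open>Inversion along rays\<close>

text \<open>Local injectivity and the open mapping theorem give an inverse on a whole ball around
  \<open>f z\<close>. Its derivative is recorded only at \<open>f z\<close>, from where the
  applications take a small first-order step.\<close>

lemma local_holomorphic_inverse:
  assumes "f holomorphic_on S" "open S" "z \<in> S" "deriv f z \<noteq> 0"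
  obtains G \<delta> where "\<delta> > 0" "(G has_field_derivative 1 / deriv f z) (at (f z))" "G (f z) = z"
    "\<And>w. w \<in> ball (f z) \<delta> \<Longrightarrow> G w \<in> S \<and> f (G w) = w"
proof -
  obtain r where r: "r > 0" "ball z r \<subseteq> S" "inj_on f (ball z r)"
    using has_complex_derivative_locally_injective assms by metis
  have hol: "f holomorphic_on ball z r"
    using assms(1) r(2) holomorphic_on_subset by blast
  obtain G where G: "G holomorphic_on f ` ball z r"
      "\<And>x. x \<in> ball z r \<Longrightarrow> deriv f x * deriv G (f x) = 1"
      "\<And>x. x \<in> ball z r \<Longrightarrow> G (f x) = x"
    using holomorphic_has_inverse[OF hol _ r(3)] by auto
  have op: "open (f ` ball z r)"
    using open_mapping_thm3[OF hol _ r(3)] by simp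
  have z: "z \<in> ball z r" using r by simp
  obtain \<delta> where \<delta>: "\<delta> > 0" "ball (f z) \<delta> \<subseteq> f ` ball z r"
    using op z by (meson image_eqI open_contains_ball)
  have "(G has_field_derivative deriv G (f z)) (at (f z))"
    using G(1) op z by (auto intro: holomorphic_derivI)
  moreover have "deriv G (f z) = 1 / deriv f z"
    using G(2)[OF z] assms(4) by (simp add: field_simps)
  moreover have "G w \<in> S \<and> f (G w) = w" if "w \<in> ball (f z) \<delta>" for w
    using that \<delta>(2) G(3) r(2) by fastforce
  ultimately show thesis using that \<delta>(1) G(3)[OF z] by metis
qed

text \<open>The difference quotient in direction \<open>u\<close> tends to \<open>D\<close>, so the
  strict bound on \<open>norm D\<close> survives for short steps.\<close>

lemma has_field_derivative_norm_bound:
  fixes G :: "complex \<Rightarrow> complex"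
  assumes "(G has_field_derivative D) (at w)" "norm D < c" "norm u = 1"
  shows "\<forall>\<^sub>F s in at_right (0::real). norm (G (w + of_real s * u) - G w) \<le> c * s"
proof -
  have "((\<lambda>h. (G (w + h) - G w) / h) \<longlongrightarrow> D) (at 0)"
    using assms(1) by (simp add: DERIV_def)
  moreover have "filterlim (\<lambda>s::real. of_real s * u) (at (0::complex)) (at_right (0::real))"
  proof -
    have "u \<noteq> 0" using assms(3) by auto
    then show ?thesis
      by (auto simp: filterlim_at eventually_at_filter intro!: tendsto_eq_intros)
  qed
  ultimately have "((\<lambda>s. (G (w + of_real s * u) - G w) / (of_real s * u)) \<longlongrightarrow> D) (at_right 0)"
    by (rule filterlim_compose)
  then have "((\<lambda>s. norm ((G (w + of_real s * u) - G w) / (of_real s * u))) \<longlongrightarrow> norm D) (at_right 0)"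
    by (rule tendsto_norm)
  then have "\<forall>\<^sub>F s in at_right 0. norm ((G (w + of_real s * u) - G w) / (of_real s * u)) < c"
    using assms(2) order_tendstoD(2) by blast
  moreover have "\<forall>\<^sub>F s in at_right (0::real). s > 0"
    by (simp add: eventually_at_filter)
  ultimately show ?thesis
    by eventually_elim (use assms(3) in \<open>auto simp: norm_divide norm_mult divide_simps\<close>)
qed

text \<open>A point over \<open>t w / |w|\<close> with \<open>t\<close> maximal exists by compactness. The factor \<open>c > 1\<close> absorbs the
  first-order error of a further step along the ray, so neither path lifting nor injectivity
  of \<open>F\<close> is needed.\<close>

lemma covering:
  fixes H h :: "real \<Rightarrow> real"
  assumes hol: "F holomorphic_on ball 0 1" and F0: "F 0 = 0"
    and mono: "strict_mono_on {0..1} H" and cont: "continuous_on {0..1} H" and H0: "H 0 = 0"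
    and dH: "\<And>x. 0 \<le> x \<Longrightarrow> x < 1 \<Longrightarrow> (H has_real_derivative h x) (at x)"
    and h_pos: "\<And>x. 0 \<le> x \<Longrightarrow> x < 1 \<Longrightarrow> h x > 0"
    and le: "\<And>z. z \<in> ball 0 1 \<Longrightarrow> h (norm z) \<le> norm (deriv F z)"
    and c: "c > 1" and w: "c * norm w < H 1"
  shows "\<exists>z\<in>ball 0 1. F z = w \<and> H (norm z) \<le> c * norm w"
proof (cases "w = 0")
  case True
  then show ?thesis using F0 H0 by (intro bexI[of _ 0]) auto
next
  case False
  define T where "T = norm w"
  define u where "u = w / of_real T"
  have T: "T > 0" and u: "norm u = 1" "w = of_real T * u"
    using False by (auto simp: T_def u_def norm_divide)
  have mono': "H x < H y \<longleftrightarrow> x < y" "H x \<le> H y \<longleftrightarrow> x \<le> y" if "x \<in> {0..1}" "y \<in> {0..1}" for x y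
    using strict_mono_on_less[OF mono that] strict_mono_on_less_eq[OF mono that] by auto
  \<comment> \<open>From \<open>H (norm z) \<le> c * t \<le> H \<rho>\<close> all candidate points
    will lie in a closed disc of radius below \<open>1\<close>.\<close>
  obtain \<rho> where \<rho>: "0 \<le> \<rho>" "\<rho> \<le> 1" "H \<rho> = c * T"
    using IVT'[of H 0 "c * T" 1] H0 w T c cont by (auto simp: T_def)
  have \<rho>1: "\<rho> < 1" using \<rho> w mono'(1)[of \<rho> 1] by (auto simp: T_def)
  define K where "K = {(z, t). z \<in> cball 0 \<rho> \<and> t \<in> {0..T} \<and> F z = of_real t * u \<and> H (norm z) \<le> c * t}"
  have cF: "continuous_on (cball 0 \<rho> \<times> {0..T}) (\<lambda>(z, t). F z - of_real t * u)"
    unfolding case_prod_unfold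
    by (intro continuous_intros continuous_on_compose2[OF holomorphic_on_imp_continuous_on[OF hol]])
       (use \<rho>1 in auto)
  have cH: "continuous_on (cball 0 \<rho> \<times> {0..T}) (\<lambda>(z, t). c * t - H (norm z))"
    unfolding case_prod_unfold
    by (intro continuous_intros continuous_on_compose2[OF cont])
       (use \<rho>1 in auto)
  have "K = (cball 0 \<rho> \<times> {0..T} \<inter> (\<lambda>(z, t). F z - of_real t * u) -` {0}) \<inter>
            (cball 0 \<rho> \<times> {0..T} \<inter> (\<lambda>(z, t). c * t - H (norm z)) -` {0..})"
    by (auto simp: K_def)
  moreover have "closed \<dots>"
    by (intro closed_Int continuous_closed_preimage[OF cF] continuous_closed_preimage[OF cH] closed_Times) auto
  ultimately have "closed K" by simp
  moreover have "K \<subseteq> cball 0 \<rho> \<times> {0..T}" by (auto simp: K_def)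
  ultimately have "compact K"
    using compact_Int_closed[OF compact_Times[OF compact_cball compact_Icc], of K 0 \<rho> 0 T]
    by (simp add: inf.absorb2)
  moreover have "(0, 0) \<in> K" using F0 H0 \<rho> T by (auto simp: K_def)
  ultimately obtain k where k: "k \<in> K" "\<And>y. y \<in> K \<Longrightarrow> snd y \<le> snd k"
    using continuous_attains_sup[of K snd] continuous_on_snd[OF continuous_on_id, of K] by fastforce
  obtain z t where zt: "k = (z, t)" by force
  have z: "norm z \<le> \<rho>" "0 \<le> t" "t \<le> T" "F z = of_real t * u" "H (norm z) \<le> c * t"
    using k(1) zt by (auto simp: K_def)
  have zb: "z \<in> ball 0 1" using z \<rho>1 by simp
  have "t = T"
  proof (rule ccontr)
    assume "t \<noteq> T"
    then have tT: "t < T" using z by simp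
    let ?h = "h (norm z)"
    have hp: "?h > 0" using h_pos z \<rho>1 by simp
    then have dz: "deriv F z \<noteq> 0" using le[OF zb] by auto
    \<comment> \<open>The mean \<open>(1 + c) / 2\<close> lies strictly between \<open>1\<close> and
      \<open>c\<close>: thus \<open>c'\<close> exceeds the speed bound \<open>1 / ?h\<close> of the
      local inverse, while \<open>H\<close> still grows at a rate below \<open>c\<close> along the
      step.\<close>
    define c' where "c' = (1 + c) / 2 / ?h"
    have c': "1 / ?h < c'" "c' > 0" "?h * c' < c" using c hp by (auto simp: c'_def field_simps)
    obtain G \<delta> where G: "\<delta> > 0" "(G has_field_derivative 1 / deriv F z) (at (F z))" "G (F z) = z"
        "\<And>w. w \<in> ball (F z) \<delta> \<Longrightarrow> G w \<in> ball 0 1 \<and> F (G w) = w"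
      using local_holomorphic_inverse[OF hol open_ball zb dz] by metis
    have "norm (1 / deriv F z) \<le> 1 / ?h"
      using le[OF zb] hp frac_le[of 1 1 ?h "norm (deriv F z)"] by (simp add: norm_divide)
    then have "norm (1 / deriv F z) < c'" using c' by linarith
    note 1 = has_field_derivative_norm_bound[OF G(2) this u(1)]
    have "((\<lambda>s. H (norm z + s)) has_real_derivative ?h) (at 0)"
      using dH[of "norm z"] z \<rho>1 DERIV_shift[of H ?h 0 "norm z"] by (simp add: add.commute)
    then have "((\<lambda>s. H (norm z + c' * s)) has_real_derivative ?h * c') (at 0)"
      by (intro DERIV_chain2[where f = "\<lambda>s. H (norm z + s)" and g = "\<lambda>s. c' * s"]
            DERIV_cong[OF DERIV_cmult_Id]) auto
    then have "((\<lambda>s. H (norm z + c' * s) - c * s) has_real_derivative ?h * c' - c) (at 0)"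
      by (auto intro!: derivative_eq_intros)
    from DERIV_neg_dec_right[OF this] c'
    obtain e where e: "e > 0" "\<And>s. 0 < s \<Longrightarrow> s < e \<Longrightarrow> H (norm z + c' * s) - c * s < H (norm z)"
      by auto
    \<comment> \<open>The four bounds on \<open>s\<close> secure, in order, the estimate for
      \<open>H\<close>, the domain of \<open>G\<close>, \<open>t + s < T\<close>, and
      \<open>norm z + c' * s < 1\<close>.\<close>
    have "0 < Min {e, \<delta>, T - t, (1 - norm z) / c'}"
      using e G tT zb c' by auto
    from eventually_at_right_real[OF this]
    obtain s where s: "s > 0" "s < e" "s < \<delta>" "s < T - t" "s < (1 - norm z) / c'"
      "norm (G (F z + of_real s * u) - G (F z)) \<le> c' * s"
      using eventually_happens[OF eventually_conj[OF 1]] by auto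
    define y where "y = G (F z + of_real s * u)"
    have y: "y \<in> ball 0 1" "F y = F z + of_real s * u"
      using G(4)[of "F z + of_real s * u"] s(1,3) u by (auto simp: y_def dist_norm norm_mult)
    have "norm y \<le> norm z + c' * s"
      using s(6) G(3) norm_triangle_sub[of y z] unfolding y_def by auto
    moreover have "norm z + c' * s < 1" using s c' by (simp add: field_simps)
    ultimately have "H (norm y) \<le> H (norm z + c' * s)"
      using mono'(2)[of "norm y" "norm z + c' * s"] c' s by auto
    also have "\<dots> \<le> c * (t + s)" using e(2)[OF s(1,2)] z(5) by (simp add: algebra_simps)
    finally have Hy: "H (norm y) \<le> c * (t + s)" .
    also have "\<dots> \<le> H \<rho>" using s c by (simp add: \<rho>)
    finally have "norm y \<le> \<rho>" using mono'(2)[of "norm y" \<rho>] \<rho> y by auto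
    then have "(y, t + s) \<in> K" using Hy y z s by (auto simp: K_def algebra_simps)
    then show False using k(2)[of "(y, t + s)"] zt s by auto
  qed
  then have "F z = w" "H (norm z) \<le> c * norm w"
    using z(4,5) u(2) T_def by metis+
  then show ?thesis using zb by blast
qed

lemma covering_ball:
  fixes H h :: "real \<Rightarrow> real"
  assumes "F holomorphic_on ball 0 1" "F 0 = 0"
    and "strict_mono_on {0..1} H" "continuous_on {0..1} H" "H 0 = 0"
    and "\<And>x. 0 \<le> x \<Longrightarrow> x < 1 \<Longrightarrow> (H has_real_derivative h x) (at x)"
    and "\<And>x. 0 \<le> x \<Longrightarrow> x < 1 \<Longrightarrow> h x > 0"
    and "\<And>z. z \<in> ball 0 1 \<Longrightarrow> h (norm z) \<le> norm (deriv F z)"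
  shows "ball 0 (H 1) \<subseteq> F ` ball 0 1"
proof
  fix w :: complex assume w: "w \<in> ball 0 (H 1)"
  have "H 1 > 0" using w norm_ge_zero[of w] by (simp only: mem_ball_0)
  then obtain c where c: "c > 1" "c * norm w < H 1"
  proof (cases "w = 0")
    case False
    then have "1 < H 1 / norm w" using w by auto
    then obtain c where "1 < c" "c < H 1 / norm w" using dense by blast
    then show thesis using that False by (simp add: field_simps)
  qed (use that[of 2] in auto)
  show "w \<in> F ` ball 0 1" using covering[OF assms c] by blast
qed

text \<open>Otherwise \<open>covering\<close> with a suitable \<open>c > 1\<close> produces a
  preimage of \<open>F z\<close> strictly closer to the origin than \<open>z\<close>, against
  univalence.\<close>

lemma growth_lower:
  fixes H h :: "real \<Rightarrow> real"
  assumes "F holomorphic_on ball 0 1" "F 0 = 0"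
    and "strict_mono_on {0..1} H" "continuous_on {0..1} H" "H 0 = 0"
    and "\<And>x. 0 \<le> x \<Longrightarrow> x < 1 \<Longrightarrow> (H has_real_derivative h x) (at x)"
    and "\<And>x. 0 \<le> x \<Longrightarrow> x < 1 \<Longrightarrow> h x > 0"
    and "\<And>z. z \<in> ball 0 1 \<Longrightarrow> h (norm z) \<le> norm (deriv F z)"
    and inj: "inj_on F (ball 0 1)" and z: "z \<in> ball 0 1"
  shows "H (norm z) \<le> norm (F z)"
proof (rule ccontr)
  assume *: "\<not> ?thesis"
  have z0: "z \<noteq> 0" using * assms(2,5) by auto
  have F0: "F z \<noteq> 0" using inj z z0 assms(2) by (metis centre_in_ball inj_onD zero_less_one)
  have "H (norm z) < H 1"
    using strict_mono_onD[OF assms(3), of "norm z" 1] z by simp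
  moreover have "1 < H (norm z) / norm (F z)" using * F0 by auto
  then obtain c where c: "1 < c" "c < H (norm z) / norm (F z)" using dense by blast
  ultimately have c': "c * norm (F z) < H (norm z)" "c * norm (F z) < H 1"
    using F0 by (auto simp: field_simps)
  obtain y where "y \<in> ball 0 1" "F y = F z" "H (norm y) \<le> c * norm (F z)"
    using covering[OF assms(1-8) c(1) c'(2)] by auto
  then show False using inj z c' by (metis inj_onD not_less)
qed

subsection \<open>Coefficients of functions with convex range\<close>

lemma has_fps_expansion_taylor_coeff:
  assumes "f holomorphic_on ball 0 1"
  shows "f has_fps_expansion fps_expansion f 0"
  using has_fps_expansion_fps_expansion[OF open_ball _ assms] by simp

lemma taylor_coeff_eqI: "f has_fps_expansion F \<Longrightarrow> taylor_coeff f n = fps_nth F n"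
  by (simp add: taylor_coeff_def fps_expansion_eqI)

lemma taylor_coeff_0: "taylor_coeff f 0 = f 0"
  by (simp add: taylor_coeff_def fps_expansion_def)

lemma taylor_coeff_norm_le_1:
  assumes hol: "f holomorphic_on ball 0 1" and le: "\<And>z. z \<in> ball 0 1 \<Longrightarrow> norm (f z) \<le> 1"
  shows "norm (taylor_coeff f n) \<le> 1"
proof -
  have "norm (taylor_coeff f n) * r ^ n \<le> 1" if r: "0 < r" "r < 1" for r
  proof -
    have "norm ((deriv ^^ n) f 0) \<le> fact n * 1 / r ^ n"
      using r hol le
      by (intro Cauchy_inequality holomorphic_on_imp_continuous_on holomorphic_on_subset[OF hol]) auto
    then show ?thesis using r
      by (simp add: taylor_coeff_def fps_expansion_def norm_divide field_simps)
  qed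
  then have "\<forall>\<^sub>F r in at_left 1. norm (taylor_coeff f n) * r ^ n \<le> 1"
    using eventually_at_left_real[of 0 1] by (auto elim: eventually_mono)
  moreover have "((\<lambda>r. norm (taylor_coeff f n) * r ^ n) \<longlongrightarrow> norm (taylor_coeff f n) * 1 ^ n) (at_left (1::real))"
    by (intro tendsto_intros)
  ultimately show ?thesis
    using tendsto_upperbound[of _ _ "at_left (1::real)"] by fastforce
qed

lemma sum_root_of_unity_powers:
  fixes \<omega> :: complex
  assumes "\<omega> ^ n = 1" "\<omega> \<noteq> 1"
  shows "(\<Sum>j<n. \<omega> ^ j) = 0"
  using geometric_sum[OF assms(2), of n] assms by simp

text \<open>Averaging \<open>\<phi>\<close> over the \<open>n\<close>-th roots of unity stays in the convex set and removes the
  coefficients of index strictly between \<open>0\<close> and \<open>n\<close>, so that the \<open>n\<close>-th coefficient of \<open>\<phi>\<close>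
  becomes accessible to the Cauchy estimate for \<open>\<sigma>\<close> composed with the average.\<close>

lemma convex_range_coeff_bound:
  assumes hol: "\<phi> holomorphic_on ball 0 1" and \<Omega>: "convex \<Omega>" "open \<Omega>" "\<phi> ` ball 0 1 \<subseteq> \<Omega>"
    and hol_\<sigma>: "\<sigma> holomorphic_on \<Omega>" and \<sigma>: "\<sigma> ` \<Omega> \<subseteq> ball 0 1" and n: "n \<ge> 1"
  shows "norm (deriv \<sigma> (\<phi> 0)) * norm (taylor_coeff \<phi> n) \<le> 1"
proof -
  define \<omega> where "\<omega> = cis (2 * pi / n)"
  have norm_\<omega>: "norm (\<omega> ^ j) = 1" for j
    by (simp add: \<omega>_def norm_power)
  define A where "A = (\<lambda>\<zeta>. \<Sum>j<n. (1 / of_nat n) * \<phi> (\<omega> ^ j * \<zeta>))"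
  define P where "P = fps_expansion \<phi> 0"
  have P: "\<phi> has_fps_expansion P"
    unfolding P_def by (rule has_fps_expansion_taylor_coeff[OF hol])
  have P_nth: "fps_nth P m = taylor_coeff \<phi> m" for m
    by (simp add: P_def taylor_coeff_def)
  define Q where "Q = (\<Sum>j<n. fps_const (1 / of_nat n) * (P oo (fps_const (\<omega> ^ j) * fps_X)))"
  have "(\<lambda>\<zeta>. \<phi> (\<omega> ^ j * \<zeta>)) has_fps_expansion (P oo (fps_const (\<omega> ^ j) * fps_X))" for j
    using has_fps_expansion_compose[OF P has_fps_expansion_cmult_left[OF has_fps_expansion_fps_X]]
    by (simp add: o_def)
  then have Q: "A has_fps_expansion Q"
    unfolding A_def Q_def by (intro has_fps_expansion_sum has_fps_expansion_cmult_left)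
  have Q_nth: "fps_nth Q m = (1 / of_nat n) * (\<Sum>j<n. (\<omega> ^ m) ^ j) * fps_nth P m" for m
  proof -
    have "fps_nth (P oo (fps_const (\<omega> ^ j) * fps_X)) m = (\<omega> ^ m) ^ j * fps_nth P m" for j
      by (simp only: fps_compose_linear fps_nth_Abs_fps power_mult[symmetric] mult.commute[of j])
    then show ?thesis
      by (simp only: Q_def fps_sum_nth fps_mult_left_const_nth sum_distrib_left sum_distrib_right mult.assoc)
  qed
  have \<omega>n: "\<omega> ^ n = 1"
    unfolding \<omega>_def Complex.DeMoivre using n by simp
  \<comment> \<open>Here \<open>\<omega> ^ m\<close> is an \<open>n\<close>-th root of unity other
    than \<open>1\<close>, so its geometric sum vanishes.\<close>
  have Q_less: "fps_nth Q m = 0" if "0 < m" "m < n" for m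
  proof -
    have "\<omega> ^ m \<noteq> 1"
    proof
      assume "\<omega> ^ m = 1"
      then have "cis (m * (2 * pi / n)) = 1" by (simp only: \<omega>_def Complex.DeMoivre)
      then obtain k :: int where "m * (2 * pi / n) = of_int k * (2 * pi)"
        by (auto simp: cis_conv_exp exp_eq_1 mult.assoc mult.left_commute)
      then have "real m = of_int k * real n" using n by (simp add: field_simps)
      then have "int m = k * int n" by (metis of_int_eq_iff of_int_mult of_int_of_nat_eq)
      then have "int n dvd int m" by simp
      then show False using that by (auto dest: dvd_imp_le)
    qed
    moreover have "(\<omega> ^ m) ^ n = 1"
      using \<omega>n by (metis power_mult mult.commute power_one)
    ultimately show ?thesis by (simp add: Q_nth sum_root_of_unity_powers)
  qed
  have Q_n: "fps_nth Q n = fps_nth P n"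
    using n by (simp add: Q_nth \<omega>n)
  have Q_0: "fps_nth Q 0 = \<phi> 0"
    using n by (simp add: Q_nth P_nth taylor_coeff_0)
  define B where "B = (\<lambda>\<zeta>. A \<zeta> - \<phi> 0)"
  define R where "R = Q - fps_const (\<phi> 0)"
  have R: "B has_fps_expansion R"
    unfolding B_def R_def by (intro has_fps_expansion_diff Q has_fps_expansion_const)
  have R_nth: "fps_nth R m = 0" if "m < n" for m
    using that Q_less Q_0 by (cases "m = 0") (auto simp: R_def)
  have R_n: "fps_nth R n = taylor_coeff \<phi> n"
    using n by (simp add: R_def Q_n P_nth)
  have \<phi>0: "\<phi> 0 \<in> \<Omega>" using \<Omega>(3) by auto
  define S where "S = fps_expansion \<sigma> (\<phi> 0)"
  have "\<sigma> analytic_on {\<phi> 0}"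
    using hol_\<sigma> \<Omega>(2) \<phi>0 analytic_at by blast
  then have "(\<lambda>w. \<sigma> (\<phi> 0 + w)) has_fps_expansion S"
    unfolding S_def by (rule analytic_at_imp_has_fps_expansion)
  then have "((\<lambda>w. \<sigma> (\<phi> 0 + w)) \<circ> B) has_fps_expansion (S oo R)"
    using R R_nth n by (intro has_fps_expansion_compose) auto
  then have comp: "(\<lambda>\<zeta>. \<sigma> (A \<zeta>)) has_fps_expansion (S oo R)"
    by (simp add: B_def o_def)
  have A_in: "A \<zeta> \<in> \<Omega>" if "\<zeta> \<in> ball 0 1" for \<zeta>
  proof -
    have "(\<Sum>j<n. (1 / real n) *\<^sub>R \<phi> (\<omega> ^ j * \<zeta>)) \<in> \<Omega>"
      using \<Omega> that n norm_\<omega> by (intro convex_sum) (auto simp: norm_mult)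
    then show ?thesis by (simp add: A_def scaleR_conv_of_real)
  qed
  have hol_A: "A holomorphic_on ball 0 1"
    unfolding A_def
    by (intro holomorphic_intros holomorphic_on_compose_gen[OF _ hol, unfolded o_def])
       (use norm_\<omega> in \<open>auto simp: norm_mult\<close>)
  have "(\<lambda>\<zeta>. \<sigma> (A \<zeta>)) holomorphic_on ball 0 1"
    using holomorphic_on_compose_gen[OF hol_A hol_\<sigma> image_subsetI[OF A_in]] by (simp add: o_def)
  moreover have "norm (\<sigma> (A \<zeta>)) \<le> 1" if "\<zeta> \<in> ball 0 1" for \<zeta>
    using \<sigma> A_in[OF that] by (force simp: less_imp_le)
  ultimately have "norm (taylor_coeff (\<lambda>\<zeta>. \<sigma> (A \<zeta>)) n) \<le> 1"
    by (rule taylor_coeff_norm_le_1)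
  also have "taylor_coeff (\<lambda>\<zeta>. \<sigma> (A \<zeta>)) n = fps_nth (S oo R) n"
    by (rule taylor_coeff_eqI[OF comp])
  also have "\<dots> = (\<Sum>i\<in>{0..n}. fps_nth S i * fps_nth (R ^ i) n)"
    by (rule fps_compose_nth)
  \<comment> \<open>\<open>R\<close> vanishes to order at least \<open>n\<close>, so
    \<open>R ^ i\<close> with \<open>i \<ge> 2\<close> has no term of degree \<open>n\<close>, and
    \<open>R ^ 0\<close> is constant. Only the linear term of \<open>\<sigma>\<close>
    contributes.\<close>
  also have "\<dots> = (\<Sum>i\<in>{1}. fps_nth S i * fps_nth (R ^ i) n)"
  proof (intro sum.mono_neutral_right ballI)
    fix i assume i: "i \<in> {0..n} - {1}"
    have "fps_nth (R ^ i) n = 0"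
    proof (cases "i = 0 \<or> R = 0")
      case True
      then show ?thesis using i n by (auto simp: power_0_left)
    next
      case False
      then have "subdegree R \<ge> n" using R_nth by (intro subdegree_geI) auto
      moreover have "i \<ge> 2" using False i by auto
      ultimately have "n < i * subdegree R"
        using n mult_le_mono[of 2 i n "subdegree R"] by linarith
      then show ?thesis by (intro nth_less_subdegree_zero) (simp add: subdegree_power)
    qed
    then show "fps_nth S i * fps_nth (R ^ i) n = 0" by simp
  qed (use n in auto)
  also have "\<dots> = deriv \<sigma> (\<phi> 0) * taylor_coeff \<phi> n"
    by (simp add: S_def fps_expansion_def R_n)
  finally show ?thesis by (simp add: norm_mult)
qed

lemma convex_function_inverse:
  assumes "convex_function g"
  obtains G where "G holomorphic_on g ` ball 0 1" "\<And>z. z \<in> ball 0 1 \<Longrightarrow> G (g z) = z"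
    "\<And>z. z \<in> ball 0 1 \<Longrightarrow> deriv g z * deriv G (g z) = 1" "G ` g ` ball 0 1 \<subseteq> ball 0 1"
    "open (g ` ball 0 1)"
proof -
  have g: "g holomorphic_on ball 0 1" "inj_on g (ball 0 1)"
    using assms by (auto simp: convex_function_def)
  obtain G where "G holomorphic_on g ` ball 0 1" "\<And>z. z \<in> ball 0 1 \<Longrightarrow> G (g z) = z"
    "\<And>z. z \<in> ball 0 1 \<Longrightarrow> deriv g z * deriv G (g z) = 1"
    using holomorphic_has_inverse[OF g(1) open_ball g(2)] by metis
  moreover have "open (g ` ball 0 1)"
    using open_mapping_thm3[OF g(1) open_ball g(2)] .
  moreover have "G ` g ` ball 0 1 \<subseteq> ball 0 1"
    using calculation(2) by auto
  ultimately show thesis using that by blast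
qed

lemma convex_function_deriv_nonzero:
  assumes "convex_function g" "z \<in> ball 0 1"
  shows "deriv g z \<noteq> 0"
  by (rule convex_function_inverse[OF assms(1)]) (use assms(2) in fastforce)

text \<open>Loewner's coefficient bound: take the inverse of \<open>g\<close> for
  \<open>\<sigma>\<close> in \<open>convex_range_coeff_bound\<close>; its derivative at
  \<open>g 0\<close> is the reciprocal of \<open>deriv g 0\<close>.\<close>

lemma convex_function_coeff_bound:
  assumes g: "convex_function g" and n: "n \<ge> 1"
  shows "norm (taylor_coeff g n) \<le> norm (deriv g 0)"
proof -
  obtain G where G: "G holomorphic_on g ` ball 0 1" "deriv g 0 * deriv G (g 0) = 1"
    "G ` g ` ball 0 1 \<subseteq> ball 0 1" "open (g ` ball 0 1)"
    by (rule convex_function_inverse[OF g]) simp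
  have "norm (deriv G (g 0)) * norm (taylor_coeff g n) \<le> 1"
    using convex_range_coeff_bound[OF _ _ G(4) order_refl G(1,3) n] g
    by (simp add: convex_function_def)
  moreover have "deriv g 0 \<noteq> 0" using G(2) by auto
  then have "norm (deriv G (g 0)) = 1 / norm (deriv g 0)"
    using arg_cong[OF G(2), of norm] by (simp add: norm_mult field_simps)
  ultimately show ?thesis using \<open>deriv g 0 \<noteq> 0\<close> by (simp add: field_simps)
qed

section \<open>Holomorphic functions with positive real part\<close>

lemma half_plane_cayley:
  assumes "Re a > 0" "Re w > 0"
  shows "w + cnj a \<noteq> 0" "norm ((w - a) / (w + cnj a)) < 1"
proof -
  show ne: "w + cnj a \<noteq> 0" using assms by (auto simp: complex_eq_iff)
  \<comment> \<open>In the right half-plane \<open>w\<close> is nearer to \<open>a\<close> than to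
    the mirror image \<open>- cnj a\<close>.\<close>
  have "norm (w - a) < norm (w + cnj a)"
    using assms by (auto simp: cmod_def power2_eq_square algebra_simps)
  then show "norm ((w - a) / (w + cnj a)) < 1"
    using ne by (simp add: norm_divide)
qed

text \<open>Caratheodory's bound, with the half-plane as convex range: the Cayley map sending
  \<open>p 0\<close> to \<open>0\<close> has derivative of modulus \<open>1 / (2 * Re (p 0))\<close>
  there.\<close>

lemma Re_pos_coeff_bound:
  assumes hol: "p holomorphic_on ball 0 1" and pos: "\<And>z. z \<in> ball 0 1 \<Longrightarrow> Re (p z) > 0"
    and n: "n \<ge> 1"
  shows "norm (taylor_coeff p n) \<le> 2 * Re (p 0)"
proof -
  let ?\<Omega> = "{w. Re w > 0}" and ?\<sigma> = "\<lambda>w. (w - p 0) / (w + cnj (p 0))"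
  have p0: "Re (p 0) > 0" using pos by simp
  have ne: "w + cnj (p 0) \<noteq> 0" if "Re w > 0" for w
    using half_plane_cayley(1)[OF p0 that] .
  have "norm (deriv ?\<sigma> (p 0)) * norm (taylor_coeff p n) \<le> 1"
  proof (rule convex_range_coeff_bound[where \<Omega> = ?\<Omega>])
    show "?\<sigma> holomorphic_on ?\<Omega>"
      using ne by (intro holomorphic_intros) auto
    show "?\<sigma> ` ?\<Omega> \<subseteq> ball 0 1"
      using half_plane_cayley(2)[OF p0] by auto
  qed (use hol pos n in \<open>auto simp: convex_halfspace_Re_gt open_halfspace_Re_gt\<close>)
  moreover have "(?\<sigma> has_field_derivative 1 / (p 0 + cnj (p 0))) (at (p 0))"
    using ne[OF p0] by (auto intro!: derivative_eq_intros simp: divide_simps)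
  then have "deriv ?\<sigma> (p 0) = 1 / (p 0 + cnj (p 0))" by (rule DERIV_imp_deriv)
  moreover have "norm (p 0 + cnj (p 0)) = 2 * Re (p 0)"
    using p0 by (simp add: complex_add_cnj)
  ultimately show ?thesis using p0 by (simp add: norm_divide field_simps)
qed

text \<open>The Cayley transform of \<open>p\<close> vanishes at \<open>0\<close> and maps into the
  unit disc, so the Schwarz lemma bounds it by \<open>norm z\<close>; the triangle inequality then
  isolates \<open>norm (p z)\<close>.\<close>

lemma Re_pos_lower_bound:
  assumes hol: "p holomorphic_on ball 0 1" and pos: "\<And>z. z \<in> ball 0 1 \<Longrightarrow> Re (p z) > 0"
    and z: "z \<in> ball 0 1"
  shows "norm (p 0) * (1 - norm z) / (1 + norm z) \<le> norm (p z)"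
proof -
  let ?\<sigma> = "\<lambda>z. (p z - p 0) / (p z + cnj (p 0))"
  have p0: "Re (p 0) > 0" using pos by simp
  have ne: "p z + cnj (p 0) \<noteq> 0" if "z \<in> ball 0 1" for z
    using half_plane_cayley(1)[OF p0 pos[OF that]] .
  have "norm (?\<sigma> z) \<le> norm z"
  proof (rule Schwarz_Lemma(1))
    show "?\<sigma> holomorphic_on ball 0 1"
      using ne by (intro holomorphic_intros hol) auto
  qed (use half_plane_cayley(2)[OF p0] pos z in auto)
  then have "norm (p z - p 0) \<le> norm z * norm (p z + cnj (p 0))"
    using ne[OF z] by (simp add: norm_divide divide_simps)
  moreover have "norm (p z + cnj (p 0)) \<le> norm (p z) + norm (p 0)"
    using norm_triangle_ineq[of "p z" "cnj (p 0)"] by simp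
  then have "norm z * norm (p z + cnj (p 0)) \<le> norm z * (norm (p z) + norm (p 0))"
    by (rule mult_left_mono) simp
  moreover have "norm (p 0) - norm (p z) \<le> norm (p z - p 0)"
    using norm_triangle_ineq2[of "p 0" "p z"] by (simp add: norm_minus_commute)
  ultimately have "norm (p 0) * (1 - norm z) \<le> norm (p z) * (1 + norm z)"
    by (simp add: algebra_simps)
  then show ?thesis
    using norm_ge_zero[of z] by (subst pos_divide_le_eq) (auto intro: add_pos_nonneg)
qed

subsection \<open>Convex functions\<close>

text \<open>The differentiated series is compared termwise with \<open>M\<close> times the sum of
  \<open>(n + 1) * r ^ n\<close>, where \<open>r = norm z\<close>.\<close>

lemma norm_deriv_le_if_coeff_bound:
  assumes hol: "g holomorphic_on ball 0 1" and z: "z \<in> ball 0 1"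
    and le: "\<And>n. n \<ge> 1 \<Longrightarrow> norm (taylor_coeff g n) \<le> M"
  shows "norm (deriv g z) \<le> M / (1 - norm z)\<^sup>2"
proof (rule norm_sums_le)
  have "deriv g has_fps_expansion fps_deriv (fps_expansion g 0)"
    by (intro has_fps_expansion_deriv has_fps_expansion_taylor_coeff hol)
  then have "(\<lambda>n. fps_nth (fps_deriv (fps_expansion g 0)) n * z ^ n) sums deriv g z"
    using z hol by (intro has_fps_expansion_imp_sums_complex[where r = 1])
      (auto intro!: holomorphic_deriv simp flip: one_ereal_def ereal_less(3))
  then show "(\<lambda>n. of_nat (Suc n) * taylor_coeff g (Suc n) * z ^ n) sums deriv g z"
    by (simp add: taylor_coeff_def)
  show "(\<lambda>n. M * (of_nat (Suc n) * norm z ^ n)) sums (M / (1 - norm z)\<^sup>2)"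
    using sums_mult[OF geometric_deriv_sums[of "norm z"], of M] z by simp
  show "norm (of_nat (Suc n) * taylor_coeff g (Suc n) * z ^ n) \<le> M * (of_nat (Suc n) * norm z ^ n)" for n
    using mult_right_mono[OF le[of "Suc n"], of "of_nat (Suc n) * norm z ^ n"]
    by (simp add: norm_mult norm_power ac_simps del: of_nat_Suc)
qed

lemma Moebius_function_has_field_derivative:
  assumes "1 - cnj w * z \<noteq> 0"
  shows "(Moebius_function 0 w has_field_derivative
    of_real (1 - (norm w)\<^sup>2) / (1 - cnj w * z)\<^sup>2) (at z)"
proof -
  have "((\<lambda>z. (z - w) / (1 - cnj w * z)) has_field_derivative
      ((1 - cnj w * z) + (z - w) * cnj w) / (1 - cnj w * z)\<^sup>2) (at z)"
    using assms by (auto intro!: derivative_eq_intros simp: power2_eq_square)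
  also have "(1 - cnj w * z) + (z - w) * cnj w = of_real (1 - (norm w)\<^sup>2)"
    using complex_norm_square[of w] by (simp add: algebra_simps)
  finally show ?thesis by (simp add: Moebius_function_simple[abs_def])
qed

text \<open>The upper bound for the derivative, applied at \<open>-a\<close> to the Koebe transform of \<open>g\<close> at \<open>a\<close>,
  is a lower bound at \<open>a\<close> for \<open>g\<close> itself.\<close>

lemma convex_function_distortion:
  assumes g: "convex_function g" and a: "a \<in> ball 0 1"
  shows "norm (deriv g 0) / (1 + norm a)\<^sup>2 \<le> norm (deriv g a)"
proof -
  let ?T = "Moebius_function 0 (-a)" and ?S = "Moebius_function 0 a"
  let ?r = "norm a"
  have r: "?r < 1" using a by simp
  have T_in: "?T z \<in> ball 0 1" "?S z \<in> ball 0 1" if "z \<in> ball 0 1" for z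
    using Moebius_function_norm_lt_1 that a by auto
  have ST: "?S (?T z) = z" "?T (?S z) = z" if "z \<in> ball 0 1" for z
    using that a by (auto intro!: Moebius_function_compose)
  have T_img: "?T ` ball 0 1 = ball 0 1"
    using T_in ST by (metis (no_types, lifting) image_eqI image_subsetI subsetI subset_antisym)
  have inj: "inj_on ?T (ball 0 1)" by (rule inj_on_inverseI[of _ ?S]) (rule ST)
  have hol: "?T holomorphic_on ball 0 1" using a by (intro Moebius_function_holomorphic) auto
  have holg: "g holomorphic_on ball 0 1" using g by (simp add: convex_function_def)
  have conv: "convex_function (g \<circ> ?T)"
    unfolding convex_function_def
  proof (intro conjI)
    show "(g \<circ> ?T) holomorphic_on ball 0 1"
      using holomorphic_on_compose[OF hol] holg T_img by simp
    show "inj_on (g \<circ> ?T) (ball 0 1)"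
      using comp_inj_on[OF inj, of g] T_img g unfolding convex_function_def by metis
    show "convex ((g \<circ> ?T) ` ball 0 1)"
      using g T_img unfolding convex_function_def image_comp[symmetric] by metis
  qed
  have dg: "(g has_field_derivative deriv g w) (at w)" if "w \<in> ball 0 1" for w
    using holomorphic_derivI[OF holg open_ball that] .
  \<comment> \<open>\<open>?T\<close> sends \<open>0\<close> to \<open>a\<close> and
    \<open>-a\<close> to \<open>0\<close>, so the derivatives of the transform at \<open>0\<close>
    and \<open>-a\<close> involve \<open>deriv g a\<close> and \<open>deriv g 0\<close>.\<close>
  have d0: "deriv (g \<circ> ?T) 0 = deriv g a * of_real (1 - ?r\<^sup>2)"
    using DERIV_chain[OF dg Moebius_function_has_field_derivative[of "-a" 0]] a
    by (intro DERIV_imp_deriv) (simp add: Moebius_function_of_zero)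
  have s: "1 - ?r\<^sup>2 > 0" using r by (simp add: abs_square_less_1)
  have *: "1 - cnj (-a) * -a = of_real (1 - ?r\<^sup>2)"
    using complex_norm_square[of a] by (simp add: mult.commute)
  have ne: "1 - cnj (-a) * -a \<noteq> 0"
    unfolding * of_real_eq_0_iff using s by linarith
  have "deriv (g \<circ> ?T) (-a) = deriv g 0 * (of_real (1 - (norm (-a))\<^sup>2) / (1 - cnj (-a) * -a)\<^sup>2)"
    using DERIV_chain[OF dg Moebius_function_has_field_derivative[OF ne]]
    by (intro DERIV_imp_deriv) (simp add: Moebius_function_eq_zero)
  also have "\<dots> = deriv g 0 / of_real (1 - ?r\<^sup>2)"
    unfolding * using s by (simp add: power2_eq_square del: of_real_diff)
  finally have d1: "norm (deriv (g \<circ> ?T) (-a)) = norm (deriv g 0) / (1 - ?r\<^sup>2)"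
    using s by (simp add: norm_divide del: of_real_diff)
  have "norm (deriv (g \<circ> ?T) (-a)) \<le> norm (deriv (g \<circ> ?T) 0) / (1 - norm (-a))\<^sup>2"
    using conv convex_function_coeff_bound[OF conv] a
    by (intro norm_deriv_le_if_coeff_bound) (auto simp: convex_function_def)
  then have "norm (deriv g 0) / (1 - ?r\<^sup>2) \<le> norm (deriv g a) * (1 - ?r\<^sup>2) / (1 - ?r)\<^sup>2"
    using s by (simp add: d1 d0 norm_mult del: of_real_diff)
  then have "norm (deriv g 0) / (1 - ?r\<^sup>2) * ((1 - ?r)\<^sup>2 / (1 - ?r\<^sup>2))
      \<le> norm (deriv g a) * (1 - ?r\<^sup>2) / (1 - ?r)\<^sup>2 * ((1 - ?r)\<^sup>2 / (1 - ?r\<^sup>2))"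
    using s by (intro mult_right_mono) auto
  also have "\<dots> = norm (deriv g a)" using s r by simp
  also have "norm (deriv g 0) / (1 - ?r\<^sup>2) * ((1 - ?r)\<^sup>2 / (1 - ?r\<^sup>2)) = norm (deriv g 0) / (1 + ?r)\<^sup>2"
  proof -
    have "1 - ?r\<^sup>2 = (1 - ?r) * (1 + ?r)" by (simp add: algebra_simps power2_eq_square)
    then show ?thesis using r by (simp add: power2_eq_square)
  qed
  finally show ?thesis .
qed

text \<open>The sign of this derivative tells whether a moving point approaches the origin; squaring
  keeps the modulus differentiable at zeros of \<open>\<gamma>\<close>.\<close>

lemma has_real_derivative_norm_power2:
  fixes \<gamma> :: "real \<Rightarrow> complex"
  assumes "(\<gamma> has_vector_derivative v) (at s)"
  shows "((\<lambda>s. (norm (\<gamma> s))\<^sup>2) has_real_derivative 2 * Re (cnj (\<gamma> s) * v)) (at s)"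
proof -
  have d: "((\<lambda>s. Re (\<gamma> s)) has_real_derivative Re v) (at s)"
       "((\<lambda>s. Im (\<gamma> s)) has_real_derivative Im v) (at s)"
    using bounded_linear.has_vector_derivative[OF bounded_linear_Re assms]
          bounded_linear.has_vector_derivative[OF bounded_linear_Im assms]
    by (auto simp: has_real_derivative_iff_has_vector_derivative)
  then show ?thesis
    unfolding cmod_power2
    by (intro DERIV_cong[OF DERIV_add[OF DERIV_power[OF d(1)] DERIV_power[OF d(2)]]])
       (simp add: algebra_simps)
qed

lemma has_vector_derivative_along:
  assumes "(G has_field_derivative D) (at (w + of_real s * u))"
  shows "((\<lambda>s. G (w + of_real s * u)) has_vector_derivative D * u) (at s)"
proof -
  have "((\<lambda>s. w + of_real s * u) has_vector_derivative u) (at s)"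
    by (auto intro!: derivative_eq_intros)
  from field_vector_diff_chain_at[OF this assms] show ?thesis
    by (simp add: o_def mult.commute)
qed

lemma Re_of_real_mult: "Re (of_real r * z) = r * Re z"
  by simp

text \<open>\<open>Re (1 / z)\<close> is \<open>Re z\<close> over the squared modulus; for
  \<open>z = 0\<close> both sides are false because \<open>1 / 0 = 0\<close>.\<close>

lemma Re_inverse_pos_iff: "Re (1 / z) > 0 \<longleftrightarrow> Re z > 0"
proof (cases "z = 0")
  case False
  then have "(Re z)\<^sup>2 + (Im z)\<^sup>2 > 0" by (simp add: sum_power2_gt_zero_iff complex_eq_iff)
  then show ?thesis by (simp add: Re_divide zero_less_divide_iff)
qed simp

text \<open>Since \<open>t g(z)\<close> with \<open>t < 1\<close> lies in the convex image, its preimage is at most as far from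
  the origin as \<open>z\<close> by the Schwarz lemma. The derivative at \<open>t = 1\<close> is \<open>g(z) / g'(z)\<close>.\<close>

lemma convex_function_starlike:
  assumes g: "convex_function g" and g0: "g 0 = 0" and z: "z \<in> ball 0 1"
  shows "Re (z * deriv g z / g z) \<ge> 0"
proof (cases "z = 0")
  case False
  obtain G where G: "G holomorphic_on g ` ball 0 1" "\<And>z. z \<in> ball 0 1 \<Longrightarrow> G (g z) = z"
    "\<And>z. z \<in> ball 0 1 \<Longrightarrow> deriv g z * deriv G (g z) = 1" "G ` g ` ball 0 1 \<subseteq> ball 0 1"
    "open (g ` ball 0 1)"
    using convex_function_inverse[OF g] by blast
  have hol: "g holomorphic_on ball 0 1" and conv: "convex (g ` ball 0 1)"
    using g by (auto simp: convex_function_def)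
  have in_img: "of_real t * g x \<in> g ` ball 0 1" if "0 \<le> t" "t \<le> 1" "x \<in> ball 0 1" for t x
  proof -
    have "(1 - t) *\<^sub>R g 0 + t *\<^sub>R g x \<in> g ` ball 0 1"
      using conv that by (intro convexD) auto
    then show ?thesis by (simp add: g0 scaleR_conv_of_real)
  qed
  have le: "norm (G (of_real t * g z)) \<le> norm z" if t: "0 \<le> t" "t \<le> 1" for t
  proof (rule Schwarz_Lemma(1)[of "\<lambda>x. G (of_real t * g x)"])
    show "(\<lambda>x. G (of_real t * g x)) holomorphic_on ball 0 1"
      using in_img[OF t]
      by (intro holomorphic_on_compose_gen[OF _ G(1), unfolded o_def] holomorphic_intros hol) auto
    show "norm (G (of_real t * g x)) < 1" if "norm x < 1" for x
      using in_img[OF t, of x] that G(4) by force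
    show "G (of_real t * g 0) = 0" using G(2)[of 0] g0 by simp
  qed (use z in auto)
  have Gd: "(G has_field_derivative deriv G (g z)) (at (g z))"
    using G(1,5) z by (auto intro: holomorphic_derivI)
  \<comment> \<open>The parameter is \<open>s = 1 - t\<close>: growing \<open>s\<close> moves the
    point from \<open>g z\<close> towards the origin.\<close>
  have "((\<lambda>s. G (g z + of_real s * (- g z))) has_vector_derivative deriv G (g z) * (- g z)) (at 0)"
    by (rule has_vector_derivative_along) (use Gd in simp)
  then have "((\<lambda>s. (norm (G (g z + of_real s * (- g z))))\<^sup>2) has_real_derivative
      2 * Re (cnj z * (deriv G (g z) * (- g z)))) (at 0)"
    using has_real_derivative_norm_power2 G(2)[OF z] by fastforce
  note D = this
  have "\<not> 2 * Re (cnj z * (deriv G (g z) * (- g z))) > 0"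
  proof
    assume "0 < 2 * Re (cnj z * (deriv G (g z) * (- g z)))"
    from DERIV_pos_inc_right[OF D this]
    obtain d where d: "d > 0" "\<And>s. 0 < s \<Longrightarrow> s < d \<Longrightarrow>
        (norm (G (g z)))\<^sup>2 < (norm (G (g z + of_real s * (- g z))))\<^sup>2"
      by auto
    define s where "s = min 1 (d / 2)"
    have s: "0 < s" "s < d" "s \<le> 1" using d(1) by (auto simp: s_def)
    have "g z + of_real s * (- g z) = of_real (1 - s) * g z" by (simp add: algebra_simps)
    then have "norm (G (g z + of_real s * (- g z))) \<le> norm z" using le[of "1 - s"] s by simp
    then have "(norm (G (g z + of_real s * (- g z))))\<^sup>2 \<le> (norm z)\<^sup>2" by (intro power_mono) auto
    then show False using d(2)[OF s(1,2)] unfolding G(2)[OF z] by linarith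
  qed
  then have nonneg: "Re (cnj z * (deriv G (g z) * g z)) \<ge> 0" by simp
  have "deriv G (g z) = 1 / deriv g z"
    using G(3)[OF z] by (metis div_by_0 nonzero_divide_eq_eq mult_zero_left mult.commute zero_neq_one)
  \<comment> \<open>This rewrites the radial velocity through the reciprocal of
    \<open>z * deriv g z / g z\<close>; reciprocals preserve the sign of the real part.\<close>
  then have eq: "cnj z * (deriv G (g z) * g z) = of_real ((norm z)\<^sup>2) * (1 / (z * deriv g z / g z))"
    using False complex_norm_square[of z] by (simp add: field_simps)
  show ?thesis
  proof (rule ccontr)
    let ?q = "z * deriv g z / g z"
    assume "\<not> ?thesis"
    then have "Re (- ?q) > 0" by simp
    then have "Re (1 / (- ?q)) > 0" by (simp only: Re_inverse_pos_iff)
    then have "Re (1 / ?q) < 0" by simp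
    then have "(norm z)\<^sup>2 * Re (1 / ?q) < 0" using False by (intro mult_pos_neg) auto
    then show False using nonneg unfolding eq Re_of_real_mult by simp
  qed
qed (simp add: g0)

lemma convex_segment_point:
  fixes a b :: complex
  assumes "convex S" "a \<in> S" "b \<in> S" "0 \<le> s" "s \<le> 1"
  shows "a + of_real s * (b - a) \<in> S"
proof -
  have "(1 - s) *\<^sub>R a + s *\<^sub>R b \<in> S" using assms by (intro convexD) auto
  then show ?thesis by (simp add: scaleR_conv_of_real algebra_simps)
qed

text \<open>The Noshiro-Warschawski argument: the real part of \<open>\<Phi> / (b - a)\<close>
  increases along the segment from \<open>a\<close> to \<open>b\<close>, having derivative
  \<open>Re (deriv \<Phi>)\<close>.\<close>

lemma Re_divided_difference_pos:
  assumes hol: "\<Phi> holomorphic_on \<Omega>" and \<Omega>: "open \<Omega>" "convex \<Omega>"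
    and pos: "\<And>w. w \<in> \<Omega> \<Longrightarrow> Re (deriv \<Phi> w) > 0"
    and ab: "a \<in> \<Omega>" "b \<in> \<Omega>" "a \<noteq> b"
  shows "Re ((\<Phi> b - \<Phi> a) / (b - a)) > 0"
proof -
  define x where "x = (\<lambda>s::real. Re (\<Phi> (a + of_real s * (b - a)) / (b - a)))"
  note in_\<Omega> = convex_segment_point[OF \<Omega>(2) ab(1,2)]
  have "x 0 < x 1"
  proof (rule DERIV_pos_imp_increasing[of 0 1 x])
    fix s :: real assume s: "0 \<le> s" "s \<le> 1"
    let ?w = "a + of_real s * (b - a)"
    have "((\<lambda>s. \<Phi> (a + of_real s * (b - a))) has_vector_derivative deriv \<Phi> ?w * (b - a)) (at s)"
      by (intro has_vector_derivative_along holomorphic_derivI[OF hol \<Omega>(1)] in_\<Omega> s)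
    then have "((\<lambda>s. \<Phi> (a + of_real s * (b - a)) / (b - a)) has_vector_derivative
        deriv \<Phi> ?w * (b - a) / (b - a)) (at s)"
      by (rule has_vector_derivative_divide)
    then have "(x has_real_derivative Re (deriv \<Phi> ?w)) (at s)"
      unfolding x_def has_real_derivative_iff_has_vector_derivative
      using bounded_linear.has_vector_derivative[OF bounded_linear_Re] ab(3) by fastforce
    then show "\<exists>y. (x has_real_derivative y) (at s) \<and> 0 < y"
      using pos[OF in_\<Omega>[OF s]] by blast
  qed simp
  then show ?thesis by (simp add: x_def diff_divide_distrib)
qed

subsection \<open>Univalence\<close>

text \<open>Otherwise the inverse would be a bounded entire function, constant by Liouville, yet
  taking the values \<open>0\<close> and \<open>1/2\<close>.\<close>

lemma univalent_range_ne_UNIV: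
  assumes hol: "f holomorphic_on ball 0 1" and inj: "inj_on f (ball 0 1)"
  shows "f ` ball 0 1 \<noteq> UNIV"
proof
  assume UNIV: "f ` ball 0 1 = UNIV"
  obtain G where G: "G holomorphic_on f ` ball 0 1" "\<And>z. z \<in> ball 0 1 \<Longrightarrow> G (f z) = z"
    using holomorphic_has_inverse[OF hol open_ball inj] by metis
  have "range G \<subseteq> ball 0 1"
  proof
    fix y assume "y \<in> range G"
    then obtain w where "y = G w" by blast
    moreover have "w \<in> f ` ball 0 1" using UNIV by simp
    ultimately show "y \<in> ball 0 1" using G(2) by auto
  qed
  then have "bounded (range G)" using bounded_ball bounded_subset by blast
  then obtain c where c: "G w = c" for w
    using Liouville_theorem[of G] G(1) UNIV by (metis constant_on_def UNIV_I)
  have "0 = c" "(1/2 :: complex) = c"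
    using c[of "f 0"] c[of "f (1/2)"] G(2)[of 0] G(2)[of "1/2"] by auto
  then show False by auto
qed

text \<open>For holomorphic \<open>f\<close> on a convex open set this is the difference quotient
  off the diagonal and the derivative on it. The integral form makes continuity across the diagonal
  a matter of parameter integrals.\<close>

definition divided_difference :: "(complex \<Rightarrow> complex) \<Rightarrow> complex \<Rightarrow> complex \<Rightarrow> complex" where
  "divided_difference f a b = integral {0..1} (\<lambda>s::real. deriv f (a + of_real s * (b - a)))"

lemma divided_difference:
  assumes hol: "f holomorphic_on S" and S: "open S" "convex S" "a \<in> S" "b \<in> S"
  shows "f b - f a = (b - a) * divided_difference f a b"
proof -
  have "((\<lambda>s. deriv f (a + of_real s * (b - a)) * (b - a)) has_integral
      f (a + of_real 1 * (b - a)) - f (a + of_real 0 * (b - a))) {0..1}"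
  proof (rule fundamental_theorem_of_calculus)
    fix s :: real assume "s \<in> {0..1}"
    then have "a + of_real s * (b - a) \<in> S" using convex_segment_point[OF S(2-4)] by simp
    note holomorphic_derivI[OF hol S(1) this]
    from has_vector_derivative_at_within[OF has_vector_derivative_along[OF this]]
    show "((\<lambda>s. f (a + of_real s * (b - a))) has_vector_derivative
        deriv f (a + of_real s * (b - a)) * (b - a)) (at s within {0..1})" .
  qed simp
  from integral_unique[OF this]
  show ?thesis by (simp add: divided_difference_def mult.commute)
qed

lemma divided_difference_refl: "divided_difference f a a = deriv f a"
  by (simp add: divided_difference_def)

lemma continuous_on_divided_difference:
  assumes hol: "f holomorphic_on S" and S: "open S" "convex S" and K: "K \<subseteq> S"
  shows "continuous_on (K \<times> K) (\<lambda>(a, b). divided_difference f a b)"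
proof -
  have "continuous_on ((K \<times> K) \<times> cbox 0 1)
      (\<lambda>(k, s::real). deriv f (fst k + of_real s * (snd k - fst k)))"
    unfolding case_prod_unfold
    by (intro continuous_on_compose2[OF holomorphic_on_imp_continuous_on[OF holomorphic_deriv[OF hol S(1)]]]
         continuous_intros) (use K in \<open>auto intro!: convex_segment_point S\<close>)
  from integral_continuous_on_param[OF this] show ?thesis
    by (simp add: divided_difference_def case_prod_unfold)
qed

text \<open>If \<open>f + t g\<close> is constant along a moving point, then the real part condition makes the
  point move towards the origin as \<open>t\<close> grows.\<close>

lemma level_point_moves_inward:
  assumes f: "f holomorphic_on ball 0 1" and g: "g holomorphic_on ball 0 1"
    and g_ne: "\<And>z. z \<in> ball 0 1 \<Longrightarrow> z \<noteq> 0 \<Longrightarrow> g z \<noteq> 0"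
    and z: "z \<in> ball 0 1" "z \<noteq> 0" and \<eta>: "\<eta> > 0"
    and pos: "Re (z * (deriv f z + of_real t * deriv g z) / g z) > 0"
  shows "\<forall>\<^sub>F s in at_right (0::real). \<exists>y. norm y \<le> norm z \<and> norm (y - z) < \<eta> \<and>
    f y + of_real (t + s) * g y = f z + of_real t * g z"
proof -
  define w where "w = f z + of_real t * g z"
  define q where "q = deriv f z + of_real t * deriv g z"
  \<comment> \<open>\<open>\<psi> x\<close> is the parameter \<open>c\<close> with
    \<open>f x + c * g x = w\<close>, so inverting \<open>\<psi>\<close> yields the level point
    belonging to \<open>c\<close>.\<close>
  define \<psi> where "\<psi> = (\<lambda>x. (w - f x) / g x)"
  have op: "open (ball 0 1 - {0::complex})" by auto
  have hol: "\<psi> holomorphic_on ball 0 1 - {0}"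
    unfolding \<psi>_def using g_ne
    by (intro holomorphic_intros holomorphic_on_subset[OF f] holomorphic_on_subset[OF g]) auto
  have gz: "g z \<noteq> 0" using g_ne z by auto
  have \<psi>z: "\<psi> z = of_real t" using gz by (simp add: \<psi>_def w_def)
  have df: "(f has_field_derivative deriv f z) (at z)" and dg: "(g has_field_derivative deriv g z) (at z)"
    using holomorphic_derivI[OF f open_ball z(1)] holomorphic_derivI[OF g open_ball z(1)] .
  have "(\<psi> has_field_derivative ((0 - deriv f z) * g z - (w - f z) * deriv g z) / (g z * g z)) (at z)"
    unfolding \<psi>_def by (intro DERIV_divide DERIV_diff DERIV_const df dg gz)
  also have "((0 - deriv f z) * g z - (w - f z) * deriv g z) / (g z * g z) = - q / g z"
    using gz by (simp add: w_def q_def field_simps)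
  finally have d\<psi>: "deriv \<psi> z = - q / g z" by (rule DERIV_imp_deriv)
  have q: "q \<noteq> 0" using pos by (auto simp: q_def)
  have zin: "z \<in> ball 0 1 - {0}" and d\<psi>0: "deriv \<psi> z \<noteq> 0" using z d\<psi> gz q by auto
  obtain G \<delta> where G: "\<delta> > 0" "(G has_field_derivative 1 / deriv \<psi> z) (at (\<psi> z))" "G (\<psi> z) = z"
      "\<And>w. w \<in> ball (\<psi> z) \<delta> \<Longrightarrow> G w \<in> ball 0 1 - {0} \<and> \<psi> (G w) = w"
    using local_holomorphic_inverse[OF hol op zin d\<psi>0] by metis
  have "((\<lambda>s. G (of_real t + of_real s * 1)) has_vector_derivative 1 / deriv \<psi> z * 1) (at 0)"
    by (rule has_vector_derivative_along) (use G(2) \<psi>z in simp)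
  then have vd: "((\<lambda>s. G (of_real t + of_real s)) has_vector_derivative - g z / q) (at 0)"
    using d\<psi> by simp
  have D: "((\<lambda>s. (norm (G (of_real t + of_real s)))\<^sup>2) has_real_derivative
      2 * Re (cnj z * (- g z / q))) (at 0)"
    using has_real_derivative_norm_power2[OF vd] G(3) \<psi>z by simp
  \<comment> \<open>The level point has velocity \<open>- g z / q\<close>; its radial part is
    negative because \<open>z * q / g z\<close>, and hence its reciprocal, has positive real
    part.\<close>
  have neg: "2 * Re (cnj z * (- g z / q)) < 0"
  proof -
    have "cnj z * (- g z / q) = - (of_real ((norm z)\<^sup>2) * (1 / (z * q / g z)))"
      using z(2) complex_norm_square[of z] gz q by (simp add: field_simps)
    moreover have "Re (1 / (z * q / g z)) > 0"
      using pos by (simp only: Re_inverse_pos_iff q_def)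
    then have "(norm z)\<^sup>2 * Re (1 / (z * q / g z)) > 0" using z(2) by simp
    ultimately show ?thesis by (simp only: uminus_complex.sel Re_of_real_mult)
  qed
  obtain d where d: "d > 0" "\<And>s. 0 < s \<Longrightarrow> s < d \<Longrightarrow>
      (norm (G (of_real t + of_real s)))\<^sup>2 < (norm (G (of_real t + of_real 0)))\<^sup>2"
    using DERIV_neg_dec_right[OF D neg] by auto
  have "isCont (\<lambda>s. G (of_real t + of_real s)) 0"
    using has_vector_derivative_continuous[OF vd] .
  then have "((\<lambda>s. norm (G (of_real t + of_real s) - z)) \<longlongrightarrow> norm (z - z)) (at 0)"
    using G(3) \<psi>z by (intro tendsto_intros) (simp add: isCont_def)
  then have "\<forall>\<^sub>F s in at (0::real). norm (G (of_real t + of_real s) - z) < \<eta>"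
    using \<eta> by (intro order_tendstoD(2)) auto
  then have "\<forall>\<^sub>F s in at_right (0::real). norm (G (of_real t + of_real s) - z) < \<eta>"
    by (auto simp: eventually_at_split)
  moreover have "\<forall>\<^sub>F s in at_right (0::real). s \<in> {0<..<min \<delta> d}"
    using G(1) d(1) by (intro eventually_at_right_real) auto
  ultimately show ?thesis
  proof eventually_elim
    case (elim s)
    let ?y = "G (of_real t + of_real s)"
    have "?y \<in> ball 0 1 - {0}" "\<psi> ?y = of_real (t + s)"
      using G(4)[of "of_real t + of_real s"] elim \<psi>z by (auto simp: dist_norm)
    then have "f ?y + of_real (t + s) * g ?y = w"
      using g_ne[of ?y] by (auto simp: \<psi>_def field_simps)
    moreover have "(norm ?y)\<^sup>2 < (norm z)\<^sup>2" using d(2)[of s] elim G(3) \<psi>z by simp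
    then have "norm ?y \<le> norm z" using power2_less_imp_less[OF _ norm_ge_zero] less_imp_le by blast
    ultimately show ?case using elim(1) unfolding w_def by (intro exI[of _ ?y] conjI)
  qed
qed

text \<open>Close-to-convexity argument without Loewner theory: among all pairs of points in a closed
  disc at which some \<open>f + t g\<close>, \<open>t \<ge> 0\<close>, takes the same value, there is one with maximal \<open>t\<close>
  (the divided difference detects critical points as well, so that this set of pairs is compact).
  Increasing \<open>t\<close> slightly moves both points inward and contradicts the maximality.\<close>

lemma inj_on_if_close_to_starlike:
  assumes f: "f holomorphic_on ball 0 1" "f 0 = 0" and g: "g holomorphic_on ball 0 1" "g 0 = 0"
    and inj_g: "inj_on g (ball 0 1)" and dg: "\<And>z. z \<in> ball 0 1 \<Longrightarrow> deriv g z \<noteq> 0"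
    and star: "\<And>z. z \<in> ball 0 1 \<Longrightarrow> Re (z * deriv g z / g z) \<ge> 0"
    and pos: "\<And>z. z \<in> ball 0 1 \<Longrightarrow> z \<noteq> 0 \<Longrightarrow> Re (z * deriv f z / g z) > 0"
    and pos_0: "Re (deriv f 0 / deriv g 0) > 0"
  shows "inj_on f (ball 0 1)"
proof (rule inj_onI, rule ccontr)
  fix a b assume ab: "a \<in> ball 0 1" "b \<in> ball 0 1" "f a = f b" "a \<noteq> b"
  have g_ne: "g z \<noteq> 0" if "z \<in> ball 0 1" "z \<noteq> 0" for z
    using inj_g that g(2) by (metis centre_in_ball inj_onD zero_less_one)
  have pos_t: "Re (z * (deriv f z + of_real t * deriv g z) / g z) > 0"
    if "z \<in> ball 0 1" "z \<noteq> 0" "t \<ge> 0" for z t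
  proof -
    have "z * (deriv f z + of_real t * deriv g z) / g z =
        z * deriv f z / g z + of_real t * (z * deriv g z / g z)"
      by (simp add: field_simps add_divide_distrib)
    then show ?thesis
      using pos[OF that(1,2)] mult_nonneg_nonneg[OF that(3) star[OF that(1)]]
      by (simp only: plus_complex.sel Re_of_real_mult)
  qed
  have ne_t: "deriv f z + of_real t * deriv g z \<noteq> 0" if "z \<in> ball 0 1" "t \<ge> 0" for z t
  proof (cases "z = 0")
    case True
    have "Re (deriv f 0 / deriv g 0 + of_real t) > 0" using pos_0 that by simp
    then have "deriv f 0 / deriv g 0 + of_real t \<noteq> 0" by (metis less_irrefl zero_complex.sel(1))
    then show ?thesis using True dg[of 0] by (simp add: field_simps)
  next
    case False
    show ?thesis
    proof
      assume "deriv f z + of_real t * deriv g z = 0"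
      then show False using pos_t[OF that(1) False that(2)] by simp
    qed
  qed
  define \<rho> where "\<rho> = max (norm a) (norm b)"
  have \<rho>: "\<rho> < 1" using ab by (simp add: \<rho>_def)
  define K where "K = cball (0::complex) \<rho>"
  have K: "K \<subseteq> ball 0 1" using \<rho> by (auto simp: K_def)
  define Df Dg where "Df = divided_difference f" and "Dg = divided_difference g"
  have Df: "f y - f x = (y - x) * Df x y" and Dg: "g y - g x = (y - x) * Dg x y"
    if "x \<in> K" "y \<in> K" for x y
    using divided_difference[OF f(1) open_ball convex_ball subsetD[OF K] subsetD[OF K], OF that]
      divided_difference[OF g(1) open_ball convex_ball subsetD[OF K] subsetD[OF K], OF that]
    unfolding Df_def Dg_def .
  have Dg_ne: "Dg x y \<noteq> 0" if "x \<in> K" "y \<in> K" for x y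
  proof (cases "x = y")
    case True
    then show ?thesis using dg[OF subsetD[OF K that(1)]] by (simp add: Dg_def divided_difference_refl)
  next
    case False
    then have "g y \<noteq> g x" using inj_onD[OF inj_g _ subsetD[OF K that(2)] subsetD[OF K that(1)]] by metis
    then show ?thesis using Dg[OF that] by auto
  qed
  \<comment> \<open>\<open>\<tau> (x, y)\<close> is the unique \<open>c\<close> for which
    \<open>f + c * g\<close> takes equal values at \<open>x\<close> and \<open>y\<close>, or has a
    critical point at \<open>x\<close> if \<open>x = y\<close>.\<close>
  define \<tau> where "\<tau> = (\<lambda>(x, y). - Df x y / Dg x y)"
  have \<tau>_eq: "\<tau> (x, y) = c \<longleftrightarrow> Df x y + c * Dg x y = 0" if "x \<in> K" "y \<in> K" for x y c
    unfolding \<tau>_def prod.case nonzero_divide_eq_eq[OF Dg_ne[OF that]] by (rule neg_eq_iff_add_eq_0)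
  have cont: "continuous_on (K \<times> K) \<tau>"
  proof -
    have "continuous_on (K \<times> K) (\<lambda>k. Df (fst k) (snd k))" "continuous_on (K \<times> K) (\<lambda>k. Dg (fst k) (snd k))"
      using continuous_on_divided_difference[OF f(1) open_ball convex_ball K]
        continuous_on_divided_difference[OF g(1) open_ball convex_ball K]
      unfolding Df_def Dg_def case_prod_unfold .
    then show ?thesis
      unfolding \<tau>_def case_prod_unfold using Dg_ne by (intro continuous_on_divide continuous_on_minus) auto
  qed
  define M where "M = K \<times> K \<inter> \<tau> -` {c. Im c = 0 \<and> Re c \<ge> 0}"
  have "closed {c. Im c = 0 \<and> Re c \<ge> 0}"
    by (intro closed_Collect_conj closed_Collect_eq closed_Collect_le continuous_intros)
  then have "closed M"
    unfolding M_def by (intro continuous_closed_preimage[OF cont]) (auto simp: K_def intro: closed_Times)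
  moreover have "M \<subseteq> K \<times> K" by (auto simp: M_def)
  ultimately have "compact M"
    using compact_Int_closed[OF compact_Times[of K K], of M] by (simp add: K_def inf.absorb2)
  moreover have ab_M: "(a, b) \<in> M"
  proof -
    have K2: "a \<in> K" "b \<in> K" by (auto simp: K_def \<rho>_def)
    then have "Df a b = 0" using Df[of a b] ab by auto
    then have "\<tau> (a, b) = 0" by (simp add: \<tau>_def)
    then show ?thesis using K2 by (simp add: M_def)
  qed
  moreover have "continuous_on M (\<lambda>k. Re (\<tau> k))"
    by (intro continuous_intros continuous_on_subset[OF cont]) (auto simp: M_def)
  ultimately obtain k where k: "k \<in> M" "\<And>k'. k' \<in> M \<Longrightarrow> Re (\<tau> k') \<le> Re (\<tau> k)"
    using continuous_attains_sup[of M "\<lambda>k. Re (\<tau> k)"] by fastforce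
  obtain x y where xy: "k = (x, y)" by force
  define t where "t = Re (\<tau> k)"
  have xyK: "x \<in> K" "y \<in> K" and t: "t \<ge> 0" "\<tau> (x, y) = of_real t"
    using k(1) by (auto simp: M_def xy t_def complex_eq_iff)
  have xyb: "x \<in> ball 0 1" "y \<in> ball 0 1" using xyK K by auto
  have Dt: "Df x y + of_real t * Dg x y = 0" using \<tau>_eq[OF xyK] t(2) by blast
  have ne: "x \<noteq> y"
    using Dt ne_t[OF xyb(1) t(1)] by (auto simp: Df_def Dg_def divided_difference_refl)
  have same: "f y + of_real t * g y = f x + of_real t * g x"
  proof -
    have "(f y - f x) + of_real t * (g y - g x) = (y - x) * (Df x y + of_real t * Dg x y)"
      unfolding Df[OF xyK] Dg[OF xyK] by (simp add: algebra_simps)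
    then show ?thesis using Dt by (simp add: algebra_simps)
  qed
  \<comment> \<open>Displacements below half the distance keep the two moved points
    distinct.\<close>
  define \<eta> where "\<eta> = norm (x - y) / 2"
  have \<eta>: "\<eta> > 0" using ne by (simp add: \<eta>_def)
  have moves: "\<forall>\<^sub>F s in at_right (0::real). \<exists>v. norm v \<le> norm z \<and> norm (v - z) < \<eta> \<and>
      f v + of_real (t + s) * g v = f z + of_real t * g z" if "z \<in> ball 0 1" for z
  proof (cases "z = 0")
    \<comment> \<open>The origin may rest, since \<open>f\<close> and \<open>g\<close> both vanish
      there.\<close>
    case True
    then show ?thesis using f(2) g(2) \<eta> by (intro always_eventually allI exI[of _ 0]) auto
  next
    case False
    show ?thesis
      using level_point_moves_inward[OF f(1) g(1) g_ne that False \<eta> pos_t[OF that False t(1)]] .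
  qed
  have "\<forall>\<^sub>F s in at_right (0::real). s > 0" by (simp add: eventually_at_filter)
  from eventually_happens'[OF trivial_limit_at_right_real
      eventually_conj[OF this eventually_conj[OF moves[OF xyb(1)] moves[OF xyb(2)]]]]
  obtain s u v where s: "s > 0"
    and u: "norm u \<le> norm x" "norm (u - x) < \<eta>"
      "f u + of_real (t + s) * g u = f x + of_real t * g x"
    and v: "norm v \<le> norm y" "norm (v - y) < \<eta>"
      "f v + of_real (t + s) * g v = f y + of_real t * g y"
    by blast
  have uvK: "u \<in> K" "v \<in> K" using u(1) v(1) xyK by (auto simp: K_def)
  have "norm (x - y) \<le> norm (u - x) + norm (u - v) + norm (v - y)"
    using norm_triangle_ineq4[of "(v - y) + (u - v)" "u - x"] norm_triangle_ineq[of "v - y" "u - v"]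
    by (simp add: algebra_simps)
  then have "u \<noteq> v" using u(2) v(2) by (auto simp: \<eta>_def)
  have "(v - u) * (Df u v + of_real (t + s) * Dg u v) = (f v - f u) + of_real (t + s) * (g v - g u)"
    unfolding Df[OF uvK] Dg[OF uvK] by (simp add: algebra_simps)
  also have "\<dots> = 0" using u(3) v(3) same by (simp add: algebra_simps)
  finally have "Df u v + of_real (t + s) * Dg u v = 0" using \<open>u \<noteq> v\<close> by simp
  then have "\<tau> (u, v) = of_real (t + s)" using \<tau>_eq[OF uvK] by blast
  then have "(u, v) \<in> M" "Re (\<tau> (u, v)) = t + s" using uvK t(1) s by (auto simp: M_def)
  then show False using k(2)[of "(u, v)"] s by (simp add: t_def)
qed

subsection \<open>Functions of the class \<open>C\<^sub>2\<close>\<close>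

text \<open>For \<open>x = m + 1\<close> the right-hand side is \<open>(m + 1)^2\<close>. The
  weights \<open>1, 2, 2, ...\<close> come from the coefficient bounds for \<open>q\<close>.\<close>

lemma sum_linear_weights:
  "(\<Sum>i=0..m. (if i = 0 then 1 else 2) * (x - real i)) = (2 * real m + 1) * x - real m * (real m + 1)"
  by (induction m) (auto simp: algebra_simps)

locale C2_pair =
  fixes f g :: "complex \<Rightarrow> complex"
  assumes hol_f: "f holomorphic_on ball 0 1" and f_0: "f 0 = 0" and deriv_f_0: "deriv f 0 = 1"
    and g: "convex_function g" and g_0: "g 0 = 0"
    and Re_pos: "\<And>z. z \<in> ball 0 1 \<Longrightarrow> Re (deriv (\<lambda>w. w * deriv f w) z / deriv g z) > 0"
begin

definition F :: "complex \<Rightarrow> complex" where "F z = z * deriv f z"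

definition q :: "complex \<Rightarrow> complex" where "q z = deriv F z / deriv g z"

lemma hol_g: "g holomorphic_on ball 0 1" and inj_g: "inj_on g (ball 0 1)"
  and convex_g: "convex (g ` ball 0 1)"
  using g by (auto simp: convex_function_def)

lemma deriv_g_nonzero: "z \<in> ball 0 1 \<Longrightarrow> deriv g z \<noteq> 0"
  by (rule convex_function_deriv_nonzero[OF g])

lemma hol_F: "F holomorphic_on ball 0 1"
  unfolding F_def[abs_def] by (intro holomorphic_intros holomorphic_deriv hol_f open_ball)

lemma hol_q: "q holomorphic_on ball 0 1"
  unfolding q_def[abs_def] using deriv_g_nonzero
  by (intro holomorphic_intros holomorphic_deriv hol_F hol_g open_ball) auto

lemma Re_q_pos: "z \<in> ball 0 1 \<Longrightarrow> Re (q z) > 0"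
  using Re_pos by (simp add: q_def F_def[abs_def])

lemma deriv_F: "z \<in> ball 0 1 \<Longrightarrow> deriv F z = q z * deriv g z"
  using deriv_g_nonzero by (simp add: q_def)

lemma F_0: "F 0 = 0"
  by (simp add: F_def)

lemma deriv_F_0: "deriv F 0 = 1"
proof -
  have "(deriv f has_field_derivative deriv (deriv f) 0) (at 0)"
    by (rule holomorphic_derivI[OF holomorphic_deriv[OF hol_f open_ball] open_ball]) simp
  then have "(F has_field_derivative 1 * deriv f 0 + deriv (deriv f) 0 * 0) (at 0)"
    unfolding F_def[abs_def] by (intro DERIV_mult DERIV_ident)
  then show ?thesis using deriv_f_0 by (simp add: DERIV_imp_deriv)
qed

lemma q_0: "q 0 * deriv g 0 = 1"
  using deriv_F[of 0] deriv_F_0 by simp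

lemma norm_q_0: "norm (q 0) * norm (deriv g 0) = 1"
  using q_0 by (metis norm_mult norm_one)

text \<open>Comparison of coefficients in \<open>deriv F = q * deriv g\<close>; the two
  differentiations in \<open>deriv F\<close> each contribute a factor \<open>n + 1\<close>.\<close>

lemma taylor_coeff_convolution:
  "of_nat ((n + 1)\<^sup>2) * taylor_coeff f (n + 1) =
    (\<Sum>i=0..n. taylor_coeff q i * (of_nat (n - i + 1) * taylor_coeff g (n - i + 1)))"
proof -
  let ?f = "fps_expansion f 0" and ?g = "fps_expansion g 0" and ?q = "fps_expansion q 0"
  have "F has_fps_expansion fps_X * fps_deriv ?f"
    unfolding F_def[abs_def]
    by (intro has_fps_expansion_mult has_fps_expansion_fps_X has_fps_expansion_deriv
        has_fps_expansion_taylor_coeff hol_f)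
  then have "deriv F has_fps_expansion fps_deriv (fps_X * fps_deriv ?f)"
    by (rule has_fps_expansion_deriv)
  moreover have "(\<lambda>z. q z * deriv g z) has_fps_expansion ?q * fps_deriv ?g"
    by (intro has_fps_expansion_mult has_fps_expansion_deriv has_fps_expansion_taylor_coeff hol_q hol_g)
  then have "deriv F has_fps_expansion ?q * fps_deriv ?g"
    by (rule has_fps_expansion_cong[THEN iffD1, rotated 2])
       (use deriv_F in \<open>auto simp: eventually_nhds intro!: exI[of _ "ball 0 1"]\<close>)
  ultimately have "fps_deriv (fps_X * fps_deriv ?f) = ?q * fps_deriv ?g"
    using fps_expansion_unique_complex by blast
  then have "fps_nth (fps_deriv (fps_X * fps_deriv ?f)) n = fps_nth (?q * fps_deriv ?g) n" by simp
  moreover have "fps_nth (fps_deriv (fps_X * fps_deriv ?f)) n = of_nat ((n + 1)\<^sup>2) * taylor_coeff f (n + 1)"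
    unfolding fps_deriv_nth[of "fps_X * _"] by (simp add: taylor_coeff_def power2_eq_square algebra_simps)
  moreover have "fps_nth (?q * fps_deriv ?g) n =
      (\<Sum>i=0..n. taylor_coeff q i * (of_nat (n - i + 1) * taylor_coeff g (n - i + 1)))"
    unfolding fps_mult_nth fps_deriv_nth taylor_coeff_def ..
  ultimately show ?thesis by metis
qed

text \<open>Since \<open>norm (q 0) * norm (deriv g 0) = 1\<close>, each summand of the convolution
  is at most its weight, and the weights add up to \<open>n^2\<close>, the factor of the
  coefficient.\<close>

lemma norm_taylor_coeff_le_1:
  assumes "n \<ge> 1"
  shows "norm (taylor_coeff f n) \<le> 1"
proof -
  obtain m where n: "n = m + 1" using assms by (metis add.commute le_Suc_ex)
  have le: "norm (taylor_coeff q i * (of_nat (m - i + 1) * taylor_coeff g (m - i + 1)))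
      \<le> (if i = 0 then 1 else 2) * (real (m + 1) - real i)" if "i \<in> {0..m}" for i
  proof -
    have "norm (taylor_coeff q i) \<le> (if i = 0 then 1 else 2) * norm (q 0)"
      using Re_pos_coeff_bound[OF hol_q Re_q_pos, of i] complex_Re_le_cmod[of "q 0"]
      by (auto simp: taylor_coeff_0)
    moreover have "norm (of_nat (m - i + 1) * taylor_coeff g (m - i + 1))
        \<le> real (m - i + 1) * norm (deriv g 0)"
      using convex_function_coeff_bound[OF g, of "m - i + 1"]
      by (simp only: norm_mult norm_of_nat) (auto intro: mult_left_mono)
    ultimately have "norm (taylor_coeff q i * (of_nat (m - i + 1) * taylor_coeff g (m - i + 1)))
        \<le> (if i = 0 then 1 else 2) * norm (q 0) * (real (m - i + 1) * norm (deriv g 0))"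
      unfolding norm_mult[of "taylor_coeff q i"] by (intro mult_mono) auto
    also have "\<dots> = (if i = 0 then 1 else 2) * real (m - i + 1) * (norm (q 0) * norm (deriv g 0))"
      by (simp only: ac_simps)
    also have "\<dots> = (if i = 0 then 1 else 2) * (real (m + 1) - real i)"
      using that by (simp add: norm_q_0 of_nat_diff)
    finally show ?thesis .
  qed
  have "real (n\<^sup>2) * norm (taylor_coeff f n) = norm (of_nat ((m + 1)\<^sup>2) * taylor_coeff f (m + 1))"
    by (simp only: n norm_mult norm_of_nat)
  also have "\<dots> \<le> (\<Sum>i=0..m. (if i = 0 then 1 else 2) * (real (m + 1) - real i))"
    unfolding taylor_coeff_convolution by (rule sum_norm_le) (rule le)
  also have "\<dots> = real (n\<^sup>2)"
    unfolding sum_linear_weights by (simp add: n power2_eq_square algebra_simps)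
  finally show ?thesis using assms by (simp add: power2_eq_square)
qed

text \<open>On the convex image of \<open>g\<close>, the composition of \<open>F\<close> with the
  inverse of \<open>g\<close> has derivative \<open>q z\<close> at \<open>g z\<close>. This yields
  univalence of \<open>F\<close> and, with \<open>a = 0\<close>, positivity of
  \<open>Re (z * deriv f z / g z)\<close>.\<close>

lemma Re_divided_difference_F_g_pos:
  assumes "a \<in> ball 0 1" "b \<in> ball 0 1" "a \<noteq> b"
  shows "Re ((F b - F a) / (g b - g a)) > 0"
proof -
  obtain G where G: "G holomorphic_on g ` ball 0 1" "\<And>z. z \<in> ball 0 1 \<Longrightarrow> G (g z) = z"
    "\<And>z. z \<in> ball 0 1 \<Longrightarrow> deriv g z * deriv G (g z) = 1" "G ` g ` ball 0 1 \<subseteq> ball 0 1"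
    "open (g ` ball 0 1)"
    using convex_function_inverse[OF g] by blast
  have hol: "(F \<circ> G) holomorphic_on g ` ball 0 1"
    by (rule holomorphic_on_compose_gen[OF G(1) hol_F G(4)])
  have "Re (deriv (F \<circ> G) w) > 0" if "w \<in> g ` ball 0 1" for w
  proof -
    obtain z where z: "z \<in> ball 0 1" "w = g z" using \<open>w \<in> _\<close> by blast
    have "(G has_field_derivative deriv G w) (at w)"
      by (rule holomorphic_derivI[OF G(1,5) that])
    moreover have "(F has_field_derivative deriv F z) (at (G w))"
      using holomorphic_derivI[OF hol_F open_ball z(1)] G(2)[OF z(1)] z(2) by simp
    ultimately have "((F \<circ> G) has_field_derivative deriv F z * deriv G w) (at w)"
      by (intro DERIV_chain)
    then have "deriv (F \<circ> G) w = q z * (deriv g z * deriv G w)"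
      by (simp add: DERIV_imp_deriv deriv_F[OF z(1)] mult.assoc)
    then show ?thesis using G(3)[OF z(1)] z Re_q_pos by simp
  qed
  moreover have "g a \<noteq> g b" using inj_g assms by (auto dest: inj_onD)
  ultimately have "Re (((F \<circ> G) (g b) - (F \<circ> G) (g a)) / (g b - g a)) > 0"
    using assms by (intro Re_divided_difference_pos[OF hol G(5) convex_g]) auto
  then show ?thesis using G(2) assms by simp
qed

lemma inj_F: "inj_on F (ball 0 1)"
proof (rule inj_onI, rule ccontr)
  fix a b assume "a \<in> ball 0 1" "b \<in> ball 0 1" "F a = F b" "a \<noteq> b"
  then show False using Re_divided_difference_F_g_pos[of a b] by simp
qed

lemma Re_F_g_pos: "z \<in> ball 0 1 \<Longrightarrow> z \<noteq> 0 \<Longrightarrow> Re (z * deriv f z / g z) > 0"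
  using Re_divided_difference_F_g_pos[of 0 z] by (simp add: F_0 g_0 F_def)

text \<open>With \<open>g\<close> starlike, the positivity in \<open>Re_F_g_pos\<close> makes
  \<open>f\<close> close-to-convex; at the origin the condition concerns \<open>q 0\<close>.\<close>

lemma inj_f: "inj_on f (ball 0 1)"
proof (rule inj_on_if_close_to_starlike[OF hol_f f_0 hol_g g_0 inj_g deriv_g_nonzero
      convex_function_starlike[OF g g_0] Re_F_g_pos])
  have "deriv f 0 / deriv g 0 = q 0"
    using q_0 deriv_g_nonzero[of 0] deriv_f_0 by (simp add: divide_simps)
  then show "Re (deriv f 0 / deriv g 0) > 0" using Re_q_pos[of 0] by simp
qed

lemma norm_deriv_F_ge:
  assumes z: "z \<in> ball 0 1"
  shows "(1 - norm z) / (1 + norm z) ^ 3 \<le> norm (deriv F z)"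
proof -
  have "(1 - norm z) / (1 + norm z) ^ 3 =
      norm (q 0) * norm (deriv g 0) * (1 - norm z) / (1 + norm z) ^ 3"
    by (simp add: norm_q_0)
  also have "\<dots> = norm (q 0) * (1 - norm z) / (1 + norm z) * (norm (deriv g 0) / (1 + norm z)\<^sup>2)"
    by (simp add: power3_eq_cube power2_eq_square ac_simps)
  also have "\<dots> \<le> norm (q z) * norm (deriv g z)"
    using z by (intro mult_mono Re_pos_lower_bound[OF hol_q Re_q_pos] convex_function_distortion[OF g]) auto
  finally show ?thesis by (simp add: deriv_F[OF z] norm_mult)
qed

text \<open>\<open>x / (1 + x)^2\<close> is the primitive, vanishing at \<open>0\<close>, of the
  lower bound for \<open>norm (deriv F z)\<close>.\<close>

lemma norm_F_ge:
  assumes z: "z \<in> ball 0 1"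
  shows "norm z / (1 + norm z)\<^sup>2 \<le> norm (F z)"
proof (rule growth_lower[where H = "\<lambda>x. x / (1 + x)\<^sup>2" and h = "\<lambda>x. (1 - x) / (1 + x) ^ 3"])
  show "strict_mono_on {0..1} (\<lambda>x::real. x / (1 + x)\<^sup>2)"
  proof (rule strict_mono_onI)
    fix x y :: real assume xy: "x \<in> {0..1}" "y \<in> {0..1}" "x < y"
    have "x * y \<le> x * 1" using xy by (intro mult_left_mono) auto
    then have "x * y < 1" using xy by simp
    \<comment> \<open>This product is the difference of the two values after
      cross-multiplication.\<close>
    then have "0 < (y - x) * (1 - x * y)" using xy by simp
    also have "\<dots> = y * (1 + x)\<^sup>2 - x * (1 + y)\<^sup>2" by (simp add: power2_eq_square algebra_simps)
    finally show "x / (1 + x)\<^sup>2 < y / (1 + y)\<^sup>2" using xy by (simp add: pos_divide_less_eq pos_less_divide_eq)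
  qed
  show "continuous_on {0..1} (\<lambda>x::real. x / (1 + x)\<^sup>2)"
    by (intro continuous_intros) auto
  show "((\<lambda>x. x / (1 + x)\<^sup>2) has_real_derivative (1 - x) / (1 + x) ^ 3) (at x)"
      if "0 \<le> x" "x < 1" for x :: real
  proof -
    have "((\<lambda>x. x / (1 + x)\<^sup>2) has_real_derivative
        (1 * (1 + x)\<^sup>2 - x * (2 * (1 + x))) / ((1 + x)\<^sup>2 * (1 + x)\<^sup>2)) (at x)"
      using that by (auto intro!: derivative_eq_intros)
    also have "1 * (1 + x)\<^sup>2 - x * (2 * (1 + x)) = (1 - x) * (1 + x)"
      by (simp add: algebra_simps power2_eq_square)
    also have "(1 - x) * (1 + x) / ((1 + x)\<^sup>2 * (1 + x)\<^sup>2) = (1 - x) / (1 + x) ^ 3"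
      using that by (simp add: power2_eq_square power3_eq_cube)
    finally show ?thesis .
  qed
qed (use hol_F F_0 inj_F z norm_deriv_F_ge in auto)

lemma norm_deriv_f_ge:
  assumes z: "z \<in> ball 0 1"
  shows "1 / (1 + norm z)\<^sup>2 \<le> norm (deriv f z)"
proof (cases "z = 0")
  case False
  then show ?thesis
    using norm_F_ge[OF z]
      mult_le_cancel_left_pos[of "norm z" "1 / (1 + norm z)\<^sup>2" "norm (deriv f z)"]
    by (simp add: F_def norm_mult)
qed (simp add: deriv_f_0)

text \<open>The primitive of \<open>1 / (1 + x)^2\<close> vanishing at \<open>0\<close> is
  \<open>x / (1 + x)\<close>, with value \<open>1 / 2\<close> at \<open>1\<close>.\<close>

lemma half_ball_subset: "ball 0 (1 / 2) \<subseteq> f ` ball 0 1"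
proof -
  have "ball 0 (1 / (1 + 1)) \<subseteq> f ` ball 0 1"
  proof (rule covering_ball[where H = "\<lambda>x. x / (1 + x)" and h = "\<lambda>x. 1 / (1 + x)\<^sup>2"])
    show "strict_mono_on {0..1} (\<lambda>x::real. x / (1 + x))"
      by (rule strict_mono_onI) (auto simp: field_simps)
    show "continuous_on {0..1} (\<lambda>x::real. x / (1 + x))"
      by (intro continuous_intros) auto
    show "((\<lambda>x. x / (1 + x)) has_real_derivative 1 / (1 + x)\<^sup>2) (at x)"
      if "0 \<le> x" "x < 1" for x :: real
      using that by (auto intro!: derivative_eq_intros simp: field_simps power2_eq_square)
  qed (use hol_f f_0 norm_deriv_f_ge in auto)
  then show ?thesis by simp
qed

text \<open>The frontier of the open image avoids the image and hence the half disc. It must be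
  shown nonempty, since \<open>infdist\<close> to the empty set is \<open>0\<close>.\<close>

lemma boundary_dist_ge: "1 / 2 \<le> boundary_dist f"
proof -
  have op: "open (f ` ball 0 1)"
    using open_mapping_thm3[OF hol_f open_ball inj_f] .
  have "f ` ball 0 1 \<noteq> {}" "f ` ball 0 1 \<noteq> UNIV"
    using univalent_range_ne_UNIV[OF hol_f inj_f] by auto
  then have ne: "frontier (f ` ball 0 1) \<noteq> {}"
    by (simp add: frontier_eq_empty)
  have "1 / 2 \<le> dist (f 0) w" if "w \<in> frontier (f ` ball 0 1)" for w
  proof -
    have "w \<notin> f ` ball 0 1" using that op by (simp add: frontier_def interior_open)
    then have "w \<notin> ball 0 (1 / 2)" using half_ball_subset by blast
    then show ?thesis by (simp add: f_0)
  qed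
  then show ?thesis
    unfolding boundary_dist_def infdist_notempty[OF ne] using ne by (intro cINF_greatest) auto
qed

end

lemma class_C2_obtain:
  assumes "f \<in> class_C2"
  obtains g where "C2_pair f g"
  using assms unfolding class_C2_def C2_pair_def by blast

subsection \<open>The radius and its sharpness\<close>

text \<open>The Bohr sum at modulus \<open>r\<close> when all coefficients have modulus
  \<open>1\<close>: the first term sums \<open>r ^ n\<close> from \<open>n = 1\<close>, the second
  \<open>(r powr p) ^ n\<close> from \<open>n = 2\<close>.\<close>

definition extremal_sum :: "real \<Rightarrow> real \<Rightarrow> real" where
  "extremal_sum p r = r / (1 - r) + (r powr p)\<^sup>2 / (1 - r powr p)"

lemma powr_less_1:
  assumes "0 \<le> r" "r < 1" "p \<ge> (1::real)"
  shows "r powr p < 1"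
  using powr_less_mono2[of p r 1] assms by simp

text \<open>With \<open>u = r powr p\<close>, the left side of the equation is
  \<open>(1 - r) * (1 - u) - 2 * (r * (1 - u) + u^2 * (1 - r))\<close>; division by
  \<open>(1 - r) * (1 - u)\<close> gives the claim.\<close>

lemma radius_equation_iff:
  assumes "0 < r" "r < 1" "p \<ge> 1"
  shows "radius_equation p r \<longleftrightarrow> extremal_sum p r = 1 / 2"
proof -
  define u where "u = r powr p"
  have u: "u < 1" using powr_less_1 assms by (simp add: u_def)
  have 1: "r powr 1 = r" using assms by simp
  have 2: "r powr (2 * p) = u\<^sup>2"
    unfolding mult_2 powr_add u_def power2_eq_square ..
  have "r powr (1 + p) = r * u" "r powr (1 + 2 * p) = r * u\<^sup>2"
    unfolding powr_add 1 2 u_def by (rule refl)+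
  then have "radius_equation p r \<longleftrightarrow> 1 - 3 * r - u - 2 * u\<^sup>2 + 3 * (r * u) + 2 * (r * u\<^sup>2) = 0"
    unfolding radius_equation_def 2 by (simp only: u_def)
  also have "\<dots> \<longleftrightarrow> 2 * (r * (1 - u) + u\<^sup>2 * (1 - r)) = (1 - r) * (1 - u)"
    by (auto simp: algebra_simps)
  also have "\<dots> \<longleftrightarrow> (r * (1 - u) + u\<^sup>2 * (1 - r)) / ((1 - r) * (1 - u)) = 1 / 2"
  proof -
    have *: "2 * x = y \<longleftrightarrow> x / y = 1 / 2" if "y \<noteq> 0" for x y :: real
      using that by (auto simp: field_simps)
    show ?thesis by (rule *) (use assms u in simp)
  qed
  also have "(r * (1 - u) + u\<^sup>2 * (1 - r)) / ((1 - r) * (1 - u)) = extremal_sum p r"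
    using assms u by (simp add: extremal_sum_def u_def add_divide_distrib)
  finally show ?thesis .
qed

lemma extremal_sum_strict_mono:
  assumes "0 \<le> r" "r < s" "s < 1" "p \<ge> 1"
  shows "extremal_sum p r < extremal_sum p s"
proof -
  have "r powr p \<le> s powr p" "s powr p < 1"
    using assms powr_less_1 by (auto intro: powr_mono2)
  then have "(r powr p)\<^sup>2 / (1 - r powr p) \<le> (s powr p)\<^sup>2 / (1 - s powr p)"
    by (intro frac_le power_mono) auto
  moreover have "r / (1 - r) < s / (1 - s)"
    using assms by (simp add: pos_divide_less_eq pos_less_divide_eq algebra_simps)
  ultimately show ?thesis by (simp add: extremal_sum_def)
qed

lemma ex1_radius_equation:
  assumes p: "p \<ge> 1"
  shows "\<exists>!r. 0 < r \<and> r < 1 \<and> radius_equation p r"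
proof -
  \<comment> \<open>The endpoints bracket the root: at \<open>1/5\<close> the sum is at most
    \<open>1/4 + 1/20\<close>, at \<open>1/2\<close> its first term alone is
    \<open>1\<close>.\<close>
  have "continuous_on {1/5..1/2} (extremal_sum p)"
    unfolding extremal_sum_def[abs_def] using powr_less_1[OF _ _ p]
    by (intro continuous_intros) (auto simp: less_imp_neq)
  moreover have "extremal_sum p (1/5) \<le> 1/2"
  proof -
    have u: "(1/5) powr p \<le> 1/5" using powr_mono'[of 1 p "1/5"] p by simp
    then have "((1/5) powr p)\<^sup>2 / (1 - (1/5) powr p) \<le> (1/5)\<^sup>2 / (1 - 1/5)"
      by (intro frac_le power_mono) auto
    also have "\<dots> = 1/20" by (simp add: power2_eq_square)
    finally have "((1/5) powr p)\<^sup>2 / (1 - (1/5) powr p) \<le> 1/20" .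
    moreover have "extremal_sum p (1/5) = 1/4 + ((1/5) powr p)\<^sup>2 / (1 - (1/5) powr p)"
      by (simp add: extremal_sum_def)
    ultimately show ?thesis by linarith
  qed
  moreover have "1/2 \<le> extremal_sum p (1/2)"
    using powr_less_1[of "1/2" p] p by (simp add: extremal_sum_def)
  ultimately obtain r where r: "1/5 \<le> r" "r \<le> 1/2" "extremal_sum p r = 1/2"
    using IVT'[of "extremal_sum p" "1/5" "1/2" "1/2"] by auto
  have "s = r" if "0 < s" "s < 1" "extremal_sum p s = 1 / 2" for s
    using extremal_sum_strict_mono[of r s p] extremal_sum_strict_mono[of s r p] that r p
    by (cases r s rule: linorder_cases) auto
  then show ?thesis using r radius_equation_iff p by (intro ex1I[of _ r]) auto
qed

lemma bohr_radius:
  assumes "p \<ge> 1"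
  shows "0 < bohr_radius p" "bohr_radius p < 1" "extremal_sum p (bohr_radius p) = 1 / 2"
  using theI'[OF ex1_radius_equation[OF assms]] radius_equation_iff[OF _ _ assms]
  by (auto simp: bohr_radius_def)

lemma sums_power_from_2:
  fixes x :: real
  assumes "0 \<le> x" "x < 1"
  shows "(\<lambda>k. x ^ (k + 2)) sums (x\<^sup>2 / (1 - x))"
  using sums_mult[OF geometric_sums[of x], of "x\<^sup>2"] assms by (simp add: power2_eq_square mult.assoc)

text \<open>This makes the second series geometric with ratio \<open>r powr p\<close>. At
  \<open>r = 0\<close> both sides are \<open>0\<close>, by \<open>0 powr x = 0\<close> and
  \<open>k + 2 > 0\<close>.\<close>

lemma powr_of_nat_mult:
  fixes r :: real
  assumes "0 \<le> r"
  shows "r powr (real (k + 2) * p) = (r powr p) ^ (k + 2)"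
proof (cases "r = 0")
  case False
  have "r powr (real (k + 2) * p) = (r powr p) powr real (k + 2)"
    by (simp only: powr_powr mult.commute[of p])
  also have "\<dots> = (r powr p) ^ (k + 2)"
    using False assms by (intro powr_realpow) simp
  finally show ?thesis .
qed simp

text \<open>Both series are dominated by geometric ones; the separate term \<open>norm z\<close>
  completes the first to \<open>r / (1 - r)\<close>.\<close>

lemma bohr_sum_le:
  assumes coeff: "\<And>n. n \<ge> 1 \<Longrightarrow> norm (taylor_coeff f n) \<le> 1" and p: "p \<ge> 1"
    and z: "z \<in> ball 0 1"
  shows "summable (majorant_term f z)" "summable (power_term p f z)"
    "bohr_sum p f z \<le> extremal_sum p (norm z)"
proof -
  let ?r = "norm z"
  let ?u = "?r powr p"
  have r: "0 \<le> ?r" "?r < 1" using z by auto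
  have u: "0 \<le> ?u" "?u < 1" using powr_less_1[OF r p] by auto
  have le1: "majorant_term f z k \<le> ?r ^ (k + 2)" for k
    using coeff[of "k + 2"] mult_right_mono[of "norm (taylor_coeff f (k + 2))" 1 "?r ^ (k + 2)"]
    by (simp add: majorant_term_def norm_mult norm_power)
  have le2: "power_term p f z k \<le> ?u ^ (k + 2)" for k
  proof -
    have "norm (taylor_coeff f (k + 2)) powr p \<le> 1"
      using coeff[of "k + 2"] p by (intro powr_le1) auto
    then have "power_term p f z k \<le> 1 * ?r powr (real (k + 2) * p)"
      unfolding power_term_def by (intro mult_right_mono) auto
    then show ?thesis by (simp only: powr_of_nat_mult[OF r(1)] mult_1)
  qed
  note s1 = sums_power_from_2[OF r] and s2 = sums_power_from_2[OF u]
  show 1: "summable (majorant_term f z)"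
    using le1 by (intro summable_comparison_test'[OF sums_summable[OF s1], of 0])
      (auto simp: majorant_term_def)
  show 2: "summable (power_term p f z)"
    using le2 by (intro summable_comparison_test'[OF sums_summable[OF s2], of 0])
      (auto simp: power_term_def)
  have "suminf (majorant_term f z) \<le> ?r\<^sup>2 / (1 - ?r)"
    using suminf_le[OF le1 1 sums_summable[OF s1]] sums_unique[OF s1] by simp
  moreover have "suminf (power_term p f z) \<le> ?u\<^sup>2 / (1 - ?u)"
    using suminf_le[OF le2 2 sums_summable[OF s2]] sums_unique[OF s2] by simp
  moreover have "?r + ?r\<^sup>2 / (1 - ?r) = ?r / (1 - ?r)"
    using r by (simp add: field_simps power2_eq_square)
  ultimately show "bohr_sum p f z \<le> extremal_sum p ?r"
    by (simp add: bohr_sum_def extremal_sum_def)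
qed

section \<open>Extremality of the half-plane map\<close>

definition half_plane_map :: "complex \<Rightarrow> complex" where
  "half_plane_map z = z / (1 - z)"

lemma one_minus_nonzero: "z \<in> ball 0 1 \<Longrightarrow> 1 - z \<noteq> (0::complex)"
  by auto

text \<open>The inverse is \<open>w / (1 + w)\<close>, so the image consists of the points nearer to
  \<open>0\<close> than to \<open>-1\<close>.\<close>

lemma half_plane_map_image: "half_plane_map ` ball 0 1 = {w. Re w > - 1 / 2}"
proof -
  have norm_less_iff: "norm w < norm (1 + w) \<longleftrightarrow> Re w > - 1 / 2" for w
    by (auto simp: cmod_def power2_eq_square algebra_simps)
  show ?thesis
  proof (intro equalityI subsetI)
    fix w assume "w \<in> half_plane_map ` ball 0 1"
    then obtain z where z: "norm z < 1" "w = z / (1 - z)" by (auto simp: half_plane_map_def)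
    then have ne: "1 - z \<noteq> 0" by auto
    have "norm w = norm z / norm (1 - z)"
      unfolding z(2) by (rule norm_divide)
    moreover have "1 + w = 1 / (1 - z)"
      using ne z(2) by (simp add: field_simps)
    ultimately have "norm w < norm (1 + w)"
      using z(1) ne by (simp add: norm_divide divide_strict_right_mono)
    then show "w \<in> {w. Re w > - 1 / 2}" by (simp add: norm_less_iff)
  next
    fix w :: complex assume "w \<in> {w. Re w > - 1 / 2}"
    then have less: "norm w < norm (1 + w)" by (simp add: norm_less_iff)
    then have ne: "1 + w \<noteq> 0" by auto
    have "w / (1 + w) \<in> ball 0 1" using less ne by (simp add: norm_divide)
    moreover have "half_plane_map (w / (1 + w)) = w"
      using ne by (simp add: half_plane_map_def field_simps)
    ultimately show "w \<in> half_plane_map ` ball 0 1" by force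
  qed
qed

lemma half_plane_map_derivative:
  assumes "z \<in> ball 0 1"
  shows "(half_plane_map has_field_derivative 1 / (1 - z)\<^sup>2) (at z)"
  unfolding half_plane_map_def[abs_def] using one_minus_nonzero[OF assms]
  by (auto intro!: derivative_eq_intros simp: power2_eq_square)

lemma convex_half_plane_map: "convex_function half_plane_map"
  unfolding convex_function_def
proof (intro conjI)
  show "half_plane_map holomorphic_on ball 0 1"
    unfolding holomorphic_on_open[OF open_ball] using half_plane_map_derivative by blast
  show "inj_on half_plane_map (ball 0 1)"
  proof (rule inj_onI)
    fix x y assume xy: "x \<in> ball 0 1" "y \<in> ball 0 1" "half_plane_map x = half_plane_map y"
    then have "x * (1 - y) = y * (1 - x)"
      using one_minus_nonzero[OF xy(1)] one_minus_nonzero[OF xy(2)]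
      by (simp add: half_plane_map_def frac_eq_eq)
    then show "x = y" by (simp add: algebra_simps)
  qed
  show "convex (half_plane_map ` ball 0 1)"
    unfolding half_plane_map_image by (rule convex_halfspace_Re_gt)
qed

text \<open>The map is its own convex witness: the quotient is
  \<open>(1 + z) / (1 - z) = 2 * half_plane_map z + 1\<close>, whose real part is positive by the
  description of the image.\<close>

lemma half_plane_map_in_class_C2: "half_plane_map \<in> class_C2"
proof -
  have d: "deriv half_plane_map z = 1 / (1 - z)\<^sup>2" if "z \<in> ball 0 1" for z
    using half_plane_map_derivative[OF that] by (rule DERIV_imp_deriv)
  have "Re (deriv (\<lambda>w. w * deriv half_plane_map w) z / deriv half_plane_map z) > 0"
    if z: "z \<in> ball 0 1" for z
  proof -
    have ne: "1 - z \<noteq> 0" using one_minus_nonzero[OF z] .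
    have "((\<lambda>w. w / (1 - w)\<^sup>2) has_field_derivative (1 + z) / (1 - z) ^ 3) (at z)"
    proof -
      have "((\<lambda>w. w / (1 - w)\<^sup>2) has_field_derivative
          (1 * (1 - z)\<^sup>2 - z * (2 * (1 - z) * (- 1))) / ((1 - z)\<^sup>2 * (1 - z)\<^sup>2)) (at z)"
        using ne by (auto intro!: derivative_eq_intros)
      also have "1 * (1 - z)\<^sup>2 - z * (2 * (1 - z) * (- 1)) = (1 + z) * (1 - z)"
        by (simp add: algebra_simps power2_eq_square)
      also have "(1 + z) * (1 - z) / ((1 - z)\<^sup>2 * (1 - z)\<^sup>2) = (1 + z) / (1 - z) ^ 3"
        using ne by (simp add: power2_eq_square power3_eq_cube)
      finally show ?thesis .
    qed
    then have "((\<lambda>w. w * deriv half_plane_map w) has_field_derivative (1 + z) / (1 - z) ^ 3) (at z)"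
      by (rule has_field_derivative_transform_within_open[OF _ open_ball z]) (simp add: d)
    then have "deriv (\<lambda>w. w * deriv half_plane_map w) z = (1 + z) / (1 - z) ^ 3"
      by (rule DERIV_imp_deriv)
    then have "deriv (\<lambda>w. w * deriv half_plane_map w) z / deriv half_plane_map z = (1 + z) / (1 - z)"
      using ne by (simp add: d[OF z] power2_eq_square power3_eq_cube)
    also have "\<dots> = 2 * half_plane_map z + 1"
      using ne by (simp add: half_plane_map_def field_simps)
    finally have "deriv (\<lambda>w. w * deriv half_plane_map w) z / deriv half_plane_map z =
      2 * half_plane_map z + 1" .
    moreover have "Re (half_plane_map z) > - 1 / 2" using half_plane_map_image z by blast
    ultimately show ?thesis by simp
  qed
  then show ?thesis
    using convex_half_plane_map d[of 0]
    by (auto simp: class_C2_def convex_function_def half_plane_map_def[of 0]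
        intro!: exI[of _ half_plane_map])
qed

lemma boundary_dist_half_plane_map: "boundary_dist half_plane_map \<le> 1 / 2"
proof -
  have "half_plane_map ` ball 0 1 = {w. (1::complex) \<bullet> w > - 1 / 2}"
    unfolding half_plane_map_image by (simp add: inner_complex_def)
  then have "frontier (half_plane_map ` ball 0 1) = {w. (1::complex) \<bullet> w = - 1 / 2}"
    by (simp only:) (rule frontier_halfspace_gt, simp)
  then have "- 1 / 2 \<in> frontier (half_plane_map ` ball 0 1)"
    by (simp add: inner_complex_def)
  then have "boundary_dist half_plane_map \<le> dist (half_plane_map 0) (- 1 / 2)"
    unfolding boundary_dist_def by (rule infdist_le)
  then show ?thesis by (simp add: half_plane_map_def)
qed

lemma taylor_coeff_half_plane_map:
  assumes "n \<ge> 1"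
  shows "taylor_coeff half_plane_map n = 1"
proof -
  have "(\<lambda>n. fps_nth (Abs_fps (\<lambda>n. if n = 0 then 0 else 1)) n * z ^ n) sums half_plane_map z"
    if "z \<in> ball 0 1" for z
  proof -
    have "(\<lambda>n. z ^ n - (if n = 0 then 1 else 0)) sums (1 / (1 - z) - 1)"
      using geometric_sums[of z] that sums_single[of 0 "\<lambda>_. 1 :: complex"]
      by (intro sums_diff) auto
    also have "1 / (1 - z) - 1 = half_plane_map z"
      using one_minus_nonzero[OF that] by (simp add: half_plane_map_def field_simps)
    finally show ?thesis by (rule sums_cong[THEN iffD1, rotated]) auto
  qed
  then have "half_plane_map has_fps_expansion Abs_fps (\<lambda>n. if n = 0 then 0 else 1)"
    by (intro has_fps_expansionI eventually_nhds_in_open[of "ball 0 1", THEN eventually_mono]) auto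
  from taylor_coeff_eqI[OF this] show ?thesis using assms by simp
qed

lemma bohr_sum_half_plane_map:
  assumes r: "0 \<le> r" "r < 1" and p: "p \<ge> 1"
  shows "bohr_sum p half_plane_map (of_real r) = extremal_sum p r"
proof -
  have "majorant_term half_plane_map (of_real r) = (\<lambda>k. r ^ (k + 2))"
    using r by (auto simp: majorant_term_def taylor_coeff_half_plane_map norm_power norm_mult)
  moreover have "power_term p half_plane_map (of_real r) = (\<lambda>k. (r powr p) ^ (k + 2))"
    using r powr_of_nat_mult[OF r(1), of _ p]
    by (auto simp: power_term_def taylor_coeff_half_plane_map)
  moreover have "r powr p < 1" using powr_less_1[OF r p] .
  ultimately have "suminf (majorant_term half_plane_map (of_real r)) = r\<^sup>2 / (1 - r)"
    "suminf (power_term p half_plane_map (of_real r)) = (r powr p)\<^sup>2 / (1 - r powr p)"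
    using sums_unique[OF sums_power_from_2[OF r]] sums_unique[OF sums_power_from_2[of "r powr p"]]
    by auto
  moreover have "r + r\<^sup>2 / (1 - r) = r / (1 - r)"
    using r by (simp add: field_simps power2_eq_square)
  ultimately show ?thesis
    using r by (simp add: bohr_sum_def extremal_sum_def)
qed

theorem theorem3p3:
  fixes p :: real
  assumes "p \<ge> 1"
  shows "(\<exists>!r. 0 < r \<and> r < 1 \<and> radius_equation p r) \<and>
    (\<forall>f\<in>class_C2. \<forall>z\<in>ball 0 1.
       summable (majorant_term f z) \<and> summable (power_term p f z)) \<and>
    (\<forall>f\<in>class_C2. \<forall>z. norm z \<le> bohr_radius p \<longrightarrow> bohr_sum p f z \<le> boundary_dist f) \<and>
    (\<forall>R > bohr_radius p.
       \<not> (\<forall>f\<in>class_C2. \<forall>z\<in>ball 0 1. norm z \<le> R \<longrightarrow> bohr_sum p f z \<le> boundary_dist f))"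
proof (intro conjI ballI allI impI)
  note R0 = bohr_radius[OF assms]
  show "\<exists>!r. 0 < r \<and> r < 1 \<and> radius_equation p r"
    by (rule ex1_radius_equation[OF assms])
  fix f assume f: "f \<in> class_C2"
  then obtain g where "C2_pair f g" by (rule class_C2_obtain)
  then interpret C2_pair f g .
  note le = bohr_sum_le[OF norm_taylor_coeff_le_1 assms]
  show "summable (majorant_term f z)" "summable (power_term p f z)" if "z \<in> ball 0 1" for z
    using le that by auto
  show "bohr_sum p f z \<le> boundary_dist f" if z: "norm z \<le> bohr_radius p" for z
  proof -
    have "bohr_sum p f z \<le> extremal_sum p (norm z)" using le(3) z R0 by simp
    also have "\<dots> \<le> extremal_sum p (bohr_radius p)"
      using extremal_sum_strict_mono[of "norm z" "bohr_radius p" p] z R0 assms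
      by (cases "norm z = bohr_radius p") auto
    also have "\<dots> \<le> boundary_dist f" using R0 boundary_dist_ge by simp
    finally show ?thesis .
  qed
next
  note R0 = bohr_radius[OF assms]
  fix R assume "R > bohr_radius p"
  \<comment> \<open>\<open>R\<close> may exceed \<open>1\<close>, so \<open>r\<close> is also kept
    below \<open>1\<close>, inside the disc.\<close>
  then obtain r where r: "bohr_radius p < r" "r < min R 1"
    using R0 dense[of "bohr_radius p" "min R 1"] by auto
  have "extremal_sum p (bohr_radius p) < extremal_sum p r"
    using r R0 assms by (intro extremal_sum_strict_mono) auto
  then have "boundary_dist half_plane_map < bohr_sum p half_plane_map (of_real r)"
    using boundary_dist_half_plane_map bohr_sum_half_plane_map[of r p] r R0 assms by simp
  moreover have "of_real r \<in> ball (0::complex) 1" "norm (of_real r :: complex) \<le> R" using r R0 by auto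
  ultimately show "\<not> (\<forall>f\<in>class_C2. \<forall>z\<in>ball 0 1. norm z \<le> R \<longrightarrow> bohr_sum p f z \<le> boundary_dist f)"
    using half_plane_map_in_class_C2 by (meson not_le)
qed

end
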